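(* Let $g,k,l,H^*,W^*>0$ be constants with $0<W^*<\sqrt{gH^*}$, let $L$ be a large positive constant (that is, $L\ge L_0$ for some $L_0>0$ depending only on $g,k,l,H^*,W^*$), and let $\Omega=(0,L)\times(0,1)$. Consider for $U=(\tilde h,w,v)^T$, a function of $(t,x,y)\in[0,\infty)\times\Omega$, the linearized two-dimensional Saint-Venant system $$U_t+A_1U_x+A_2U_y=BU,$$ $$A_1=\begin{pmatrix}W^*&\sqrt{gH^*}&0\\\sqrt{gH^*}&W^*&0\\0&0&W^*\end{pmatrix},\quad A_2=\begin{pmatrix}0&0&\sqrt{gH^*}\\0&0&0\\\sqrt{gH^*}&0&0\end{pmatrix},\quad B=\begin{pmatrix}0&0&0\\0&-k&l\\0&-l&-k\end{pmatrix},$$ with the boundary conditions - $v(t,x,1)=0$ for $x\in(0,L)$, and $v(t,x,0)=0$ for $x\in(0,\tfrac L3)\cup(\tfrac{2L}3,L)$; - $[\tilde h-w](t,L,y)=k_1[\tilde h+w](t,L,y)$ for $y\in(0,1)$; - $[\tilde h+w](t,0,y)=k_2[\tilde h-w](t,0,y)$ for $y\in(0,1)$; - $[\tilde h+v](t,x,0)=k_3[\tilde h-v](t,x,0)$ for $x\in(\tfrac L3,\tfrac{2L}3)$; - $v(t,0,y)=k_4[\tilde h-v](t,\tfrac L3(y+1),0)$ for $y\in(0,1)$, where $k_1,k_2,k_3,k_4$ are real constants. Suppose that $k_1\in(-1,1)$, that $k_2\ne-1$ is such that $\frac{k_2-1}{k_2+1}$ lies between the two real roots of the quadratic $s\mapsto\frac{W^*}{2\sqrt{gH^*}}s^2+s+\frac{W^*}{2\sqrt{gH^*}}$,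 that $k_3\in(-1,1)$, and that $|k_4|$ is small enough (i.e. $|k_4|\le\kappa$ for some $\kappa>0$ depending only on the other constants). Then the boundary term $$\mathcal{BC}=\int_{\partial\Omega}(2L-x)\,U^T(n_1A_1+n_2A_2)U\,d\ell$$ is non-negative for every solution $U$. Consequently, boundary stabilization is achieved: there are positive constants $\nu,C$ such that every solution with initial data $U_0\in L^2(\Omega)$ satisfies $\|U(t)\|\le C\exp(-\nu t)\|U_0\|$ for all $t\ge0$.
   Context: Here $(n_1,n_2)$ is the unit outward normal on $\partial\Omega$, $d\ell$ is arc length measure, and $\|U(t)\|^2=\int_\Omega U^TU\,dx\,dy$. Solutions are understood as $L^2$-solutions of the initial-boundary value problem (existence taken as known), such that the boundary integral and Green's formula make sense. Origin of the system: it is the linearization, around a constant steady state $(H^*,W^*,V^* )$ with $V^*=0$, of the 2-D Saint-Venant equations with linear drag coefficient $k$ and Coriolis coefficient $l$ ($g$ is the gravity constant); $w$ and $v$ are the velocity deviations in the $x$- and $y$-directions, and $\tilde h=\sqrt{g/H^*}\,h$ is the rescaled water depth deviation $h$. The domain is a rectangular open channel, $L$ being the (large) distance between two sluices. The boundary $y=1$ and the part $y=0$, $x\in(0,L/3)\cup(2L/3,L)$, are solid walls, the part $y=0$, $x\in(L/3,2L/3)$, is a spillway, and $x=0$, $x=L$ are sluice gates. The weight $2L-x$ is the one used in the Lyapunov function $\int_\Omega(2L-x)U^TU\,dx\,dy$; the constant term $2L$ of the weight has to be large for the Lyapunov estimate. *)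

theory Defs
  imports "HOL-Analysis.Analysis"
begin

section \<open>The linearized Saint-Venant system\<close>

text \<open>
  The state vector is \<open>U = (h, w, v)\<close>, with \<open>h\<close> the rescaled depth deviation, so \<open>U $ 1 = h\<close>,
  \<open>U $ 2 = w\<close>, \<open>U $ 3 = v\<close>. \<open>H\<close> and \<open>W\<close> are the steady-state depth and velocity.
\<close>

definition A1 :: "real \<Rightarrow> real \<Rightarrow> real \<Rightarrow> real^3^3" where
  "A1 g H W = vector [vector [W, sqrt (g * H), 0],
                      vector [sqrt (g * H), W, 0],
                      vector [0, 0, W]]"

definition A2 :: "real \<Rightarrow> real \<Rightarrow> real^3^3" where
  "A2 g H = vector [vector [0, 0, sqrt (g * H)],
                    vector [0, 0, 0],
                    vector [sqrt (g * H), 0, 0]]"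

definition B :: "real \<Rightarrow> real \<Rightarrow> real^3^3" where
  "B k l = vector [vector [0, 0, 0],
                   vector [0, - k, l],
                   vector [0, - l, - k]]"

definition Omega :: "real \<Rightarrow> (real \<times> real) set" where
  "Omega L = {0<..<L} \<times> {0<..<1}"

definition wall0 :: "real \<Rightarrow> real set" where
  "wall0 L = {0<..<L/3} \<union> {2*L/3<..<L}"

definition spillway :: "real \<Rightarrow> real set" where
  "spillway L = {L/3<..<2*L/3}"

text \<open>
  A solution is a function \<open>U t x y\<close> with \<open>(x, y)\<close> in the \<^emph>\<open>closed\<close> rectangle. Its values in the open
  rectangle represent an \<open>L\<^sup>2\<close> class for each \<open>t\<close>; its values on the sides, a null set of the plane,
  represent the boundary trace, which \<open>strong_solution\<close> below ties to the interior values.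
\<close>

definition boundary_conditions ::
  "real \<Rightarrow> real \<Rightarrow> real \<Rightarrow> real \<Rightarrow> real \<Rightarrow> (real \<Rightarrow> real \<Rightarrow> real \<Rightarrow> real^3) \<Rightarrow> bool" where
  "boundary_conditions L k1 k2 k3 k4 U \<longleftrightarrow>
     (AE (t, x) in lborel. 0 < t \<and> x \<in> {0<..<L} \<longrightarrow> U t x 1 $ 3 = 0) \<and>
     (AE (t, x) in lborel. 0 < t \<and> x \<in> wall0 L \<longrightarrow> U t x 0 $ 3 = 0) \<and>
     (AE (t, y) in lborel. 0 < t \<and> y \<in> {0<..<1} \<longrightarrow>
        U t L y $ 1 - U t L y $ 2 = k1 * (U t L y $ 1 + U t L y $ 2)) \<and>
     (AE (t, y) in lborel. 0 < t \<and> y \<in> {0<..<1} \<longrightarrow>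
        U t 0 y $ 1 + U t 0 y $ 2 = k2 * (U t 0 y $ 1 - U t 0 y $ 2)) \<and>
     (AE (t, x) in lborel. 0 < t \<and> x \<in> spillway L \<longrightarrow>
        U t x 0 $ 1 + U t x 0 $ 3 = k3 * (U t x 0 $ 1 - U t x 0 $ 3)) \<and>
     (AE (t, y) in lborel. 0 < t \<and> y \<in> {0<..<1} \<longrightarrow>
        U t 0 y $ 3 = k4 * (U t (L/3 * (y + 1)) 0 $ 1 - U t (L/3 * (y + 1)) 0 $ 3))"


section \<open>Strong \<open>L\<^sup>2\<close>-solutions\<close>

text \<open>
  Convergence in \<open>L\<^sup>p(S)\<close> (here \<open>p\<close> is 1 or 2) to a Borel function \<open>f\<close> in \<open>L\<^sup>p(S)\<close>. The nonnegative
  integrals are extended-valued, so convergence to 0 forces the differences to be eventually in \<open>L\<^sup>p\<close>.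
\<close>

definition in_Lp :: "nat \<Rightarrow> 'a::euclidean_space set \<Rightarrow> ('a \<Rightarrow> 'b::euclidean_space) \<Rightarrow> bool" where
  "in_Lp p S f \<longleftrightarrow> set_borel_measurable lborel S f \<and>
     (\<integral>\<^sup>+z\<in>S. ennreal (norm (f z) ^ p) \<partial>lborel) < \<infinity>"

definition Lp_tendsto ::
  "nat \<Rightarrow> 'a::euclidean_space set \<Rightarrow> (nat \<Rightarrow> 'a \<Rightarrow> 'b::euclidean_space) \<Rightarrow> ('a \<Rightarrow> 'b) \<Rightarrow> bool" where
  "Lp_tendsto p S F f \<longleftrightarrow> in_Lp p S f \<and>
     (\<lambda>n. \<integral>\<^sup>+z\<in>S. ennreal (norm (F n z - f z) ^ p) \<partial>lborel) \<longlonglongrightarrow> 0"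

text \<open>\<open>\<Phi>\<close> is continuously differentiable with partial derivatives \<open>\<Phi>t\<close>, \<open>\<Phi>x\<close>, \<open>\<Phi>y\<close>.\<close>

definition C1_with_partials ::
  "(real \<Rightarrow> real \<Rightarrow> real \<Rightarrow> real^3) \<Rightarrow> (real \<Rightarrow> real \<Rightarrow> real \<Rightarrow> real^3) \<Rightarrow>
   (real \<Rightarrow> real \<Rightarrow> real \<Rightarrow> real^3) \<Rightarrow> (real \<Rightarrow> real \<Rightarrow> real \<Rightarrow> real^3) \<Rightarrow> bool" where
  "C1_with_partials \<Phi> \<Phi>t \<Phi>x \<Phi>y \<longleftrightarrow>
     (\<forall>t x y. ((\<lambda>s. \<Phi> s x y) has_vector_derivative \<Phi>t t x y) (at t) \<and>
              ((\<lambda>s. \<Phi> t s y) has_vector_derivative \<Phi>x t x y) (at x) \<and>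
              ((\<lambda>s. \<Phi> t x s) has_vector_derivative \<Phi>y t x y) (at y)) \<and>
     continuous_on UNIV (\<lambda>(t, x, y). \<Phi>t t x y) \<and>
     continuous_on UNIV (\<lambda>(t, x, y). \<Phi>x t x y) \<and>
     continuous_on UNIV (\<lambda>(t, x, y). \<Phi>y t x y)"

text \<open>
  Convergence of the boundary values on \<open>(0, T) \<times> \<partial>\<Omega>\<close>. On the gates and the spillway the conormal
  trace \<open>(n\<^sub>1 A\<^sub>1 + n\<^sub>2 A\<^sub>2) U\<close> converges in \<open>L\<^sup>2\<close> (the sign of the normal is irrelevant); as
  \<open>A\<^sub>2 (h, w, v) = sqrt (g H) (v, 0, h)\<close>, no trace of \<open>w\<close> on the sides \<open>y = 0\<close>, \<open>y = 1\<close> is involved.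
  On the solid walls \<open>h\<close> need not have an \<open>L\<^sup>2\<close> trace; only \<open>v\<close> and the flux density
  \<open>U\<^sup>T A\<^sub>2 U = 2 sqrt (g H) h v\<close> of Green's formula are required to converge. This holds when the
  conormal trace converges in \<open>L\<^sup>2\<close>, and also when \<open>v = 0\<close> on the walls for all the approximations.
\<close>

definition wall_trace_tendsto ::
  "real \<Rightarrow> real \<Rightarrow> (real \<times> real) set \<Rightarrow> (nat \<Rightarrow> real \<times> real \<Rightarrow> real^3) \<Rightarrow>
   (real \<times> real \<Rightarrow> real^3) \<Rightarrow> bool" where
  "wall_trace_tendsto g H S F f \<longleftrightarrow>
     Lp_tendsto 2 S (\<lambda>n z. F n z $ 3) (\<lambda>z. f z $ 3) \<and>
     Lp_tendsto 1 S (\<lambda>n z. F n z \<bullet> (A2 g H *v F n z)) (\<lambda>z. f z \<bullet> (A2 g H *v f z))"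

definition traces_tendsto ::
  "real \<Rightarrow> real \<Rightarrow> real \<Rightarrow> real \<Rightarrow> real \<Rightarrow> (nat \<Rightarrow> real \<Rightarrow> real \<Rightarrow> real \<Rightarrow> real^3) \<Rightarrow>
   (real \<Rightarrow> real \<Rightarrow> real \<Rightarrow> real^3) \<Rightarrow> bool" where
  "traces_tendsto g H W L T \<Phi> U \<longleftrightarrow>
     Lp_tendsto 2 ({0<..<T} \<times> {0<..<1})
       (\<lambda>n (t, y). A1 g H W *v \<Phi> n t 0 y) (\<lambda>(t, y). A1 g H W *v U t 0 y) \<and>
     Lp_tendsto 2 ({0<..<T} \<times> {0<..<1})
       (\<lambda>n (t, y). A1 g H W *v \<Phi> n t L y) (\<lambda>(t, y). A1 g H W *v U t L y) \<and>
     Lp_tendsto 2 ({0<..<T} \<times> spillway L)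
       (\<lambda>n (t, x). A2 g H *v \<Phi> n t x 0) (\<lambda>(t, x). A2 g H *v U t x 0) \<and>
     wall_trace_tendsto g H ({0<..<T} \<times> wall0 L)
       (\<lambda>n (t, x). \<Phi> n t x 0) (\<lambda>(t, x). U t x 0) \<and>
     wall_trace_tendsto g H ({0<..<T} \<times> {0<..<L})
       (\<lambda>n (t, x). \<Phi> n t x 1) (\<lambda>(t, x). U t x 1)"

text \<open>
  Strong \<open>L\<^sup>2\<close>-solutions in the sense of Friedrichs: on every \<open>[0, T]\<close>, \<open>U\<close> is a limit of functions
  of class \<open>C\<^sup>1\<close> up to the boundary whose residuals in the differential equation tend to 0 in \<open>L\<^sup>2\<close>
  and whose boundary values converge to those of \<open>U\<close>. The approximations need not satisfy the boundary
  or initial conditions. Passing to the limit, \<open>U\<close> solves the system in the sense of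
  distributions, and classical solutions of class \<open>C\<^sup>1\<close> up to the boundary are included
  (take constant sequences).
\<close>

definition strong_solution ::
  "real \<Rightarrow> real \<Rightarrow> real \<Rightarrow> real \<Rightarrow> real \<Rightarrow> real \<Rightarrow> (real \<Rightarrow> real \<Rightarrow> real \<Rightarrow> real^3) \<Rightarrow> bool" where
  "strong_solution g k l H W L U \<longleftrightarrow>
     (\<forall>T>0. \<exists>\<Phi> \<Phi>t \<Phi>x \<Phi>y.
        (\<forall>n. C1_with_partials (\<Phi> n) (\<Phi>t n) (\<Phi>x n) (\<Phi>y n)) \<and>
        Lp_tendsto 2 ({0<..<T} \<times> Omega L)
          (\<lambda>n (t, x, y). \<Phi>t n t x y + A1 g H W *v \<Phi>x n t x y + A2 g H *v \<Phi>y n t x y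
                           - B k l *v \<Phi> n t x y)
          (\<lambda>_. 0) \<and>
        (\<forall>t\<in>{0..T}. Lp_tendsto 2 (Omega L) (\<lambda>n (x, y). \<Phi> n t x y) (\<lambda>(x, y). U t x y)) \<and>
        traces_tendsto g H W L T \<Phi> U)"

definition ibvp_solution ::
  "real \<Rightarrow> real \<Rightarrow> real \<Rightarrow> real \<Rightarrow> real \<Rightarrow> real \<Rightarrow> real \<Rightarrow> real \<Rightarrow> real \<Rightarrow> real \<Rightarrow>
   (real \<Rightarrow> real \<Rightarrow> real^3) \<Rightarrow> (real \<Rightarrow> real \<Rightarrow> real \<Rightarrow> real^3) \<Rightarrow> bool" where
  "ibvp_solution g k l H W L k1 k2 k3 k4 U0 U \<longleftrightarrow>
     strong_solution g k l H W L U \<and>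
     boundary_conditions L k1 k2 k3 k4 U \<and>
     (AE (x, y) in lborel. (x, y) \<in> Omega L \<longrightarrow> U 0 x y = U0 x y)"


section \<open>The boundary term and the \<open>L\<^sup>2\<close> norm\<close>

text \<open>
  \<open>F x y (n\<^sub>1, n\<^sub>2)\<close> is the integrand at \<open>(x, y) \<in> \<partial>\<Omega>\<close> with outward unit normal \<open>(n\<^sub>1, n\<^sub>2)\<close>; each side
  of the rectangle is parametrized by arc length.
\<close>

definition boundary_integral :: "real \<Rightarrow> (real \<Rightarrow> real \<Rightarrow> real \<times> real \<Rightarrow> real) \<Rightarrow> real" where
  "boundary_integral L F =
     (LINT y:{0<..<1}|lborel. F L y (1, 0)) + (LINT y:{0<..<1}|lborel. F 0 y (-1, 0)) +
     (LINT x:{0<..<L}|lborel. F x 1 (0, 1)) + (LINT x:{0<..<L}|lborel. F x 0 (0, -1))"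

text \<open>
  For a strong solution satisfying the boundary conditions, the four integrands are integrable
  for almost every \<open>t > 0\<close>.
\<close>

definition BC :: "real \<Rightarrow> real \<Rightarrow> real \<Rightarrow> real \<Rightarrow> (real \<Rightarrow> real \<Rightarrow> real \<Rightarrow> real^3) \<Rightarrow> real \<Rightarrow> real" where
  "BC g H W L U t = boundary_integral L (\<lambda>x y (n1, n2).
     (2 * L - x) * (U t x y \<bullet> ((n1 *\<^sub>R A1 g H W + n2 *\<^sub>R A2 g H) *v U t x y)))"

definition L2_norm_on :: "real \<Rightarrow> (real \<Rightarrow> real \<Rightarrow> real^3) \<Rightarrow> real" where
  "L2_norm_on L u = sqrt (LINT (x, y):Omega L|lborel. u x y \<bullet> u x y)"

end

theory Submission
  imports Defs
begin

text \<open>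
  Let \<open>c = sqrt (g H)\<close> and \<open>E(t) = \<integral>\<^sub>\<Omega> (2L - x) |U|\<^sup>2\<close>. Green's formula gives
  \<open>E' = -BC - \<integral> U\<^sup>T A1 U - 2k \<integral> (2L - x) (w\<^sup>2 + v\<^sup>2)\<close>, where the second term comes from differentiating
  the weight. It controls \<open>h\<close>, and for \<open>L \<ge> c\<^sup>2 / (k W)\<close> the drag absorbs its cross term \<open>2 c h w\<close>, so
  that \<open>E' \<le> -BC - W/2 \<integral> |U|\<^sup>2\<close>. In \<open>BC\<close> only the term \<open>W v\<^sup>2\<close> at \<open>x = 0\<close> has the wrong sign; by the
  feedback law it is \<open>k4\<^sup>2\<close> times the square of \<open>h - v\<close> on the spillway, which the outflow through
  the spillway dominates when \<open>12 W k4\<^sup>2 \<le> L c (1 - k3\<^sup>2)\<close>.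

  For strong solutions the identity, multiplied by \<open>exp (a t)\<close> with \<open>a = W / (8L)\<close>, is applied to
  the smooth approximations. Half of the dissipation absorbs the residuals, so no uniform bound on
  the approximations is needed, and only then is the limit taken.
\<close>

section \<open>Integration over products\<close>

text \<open>Integrability on the compact closure of \<open>S\<close> restricts to \<open>S\<close>.
  This covers every integral of the smooth approximations over the open cylinder and its
  sides.\<close>

lemma set_integrable_continuous_bounded:
  fixes f :: "'a::euclidean_space \<Rightarrow> real"
  assumes "continuous_on UNIV f" "bounded S" "S \<in> sets borel"
  shows "set_integrable lborel S f"
proof -
  have "set_integrable lborel (closure S) f"
    unfolding set_integrable_def
    by (rule borel_integrable_compact)
      (use assms in \<open>auto simp: compact_closure intro: continuous_on_subset\<close>)
  then show ?thesis
    by (rule set_integrable_subset) (use assms closure_subset in auto)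
qed

lemma set_integral_Times:
  fixes f :: "'a::euclidean_space \<times> 'b::euclidean_space \<Rightarrow> real"
  assumes "set_integrable lborel (X \<times> Y) f"
  shows set_integral_Times_AE: "AE x in lborel. x \<in> X \<longrightarrow> set_integrable lborel Y (\<lambda>y. f (x, y))"
    and set_integral_Times_integrable: "set_integrable lborel X (\<lambda>x. LINT y:Y|lborel. f (x, y))"
    and set_integral_Times_fst:
      "(LINT x:X|lborel. LINT y:Y|lborel. f (x, y)) = (LINT z:X \<times> Y|lborel. f z)"
    and set_integral_Times_snd:
      "(LINT y:Y|lborel. LINT x:X|lborel. f (x, y)) = (LINT z:X \<times> Y|lborel. f z)"
proof -
  let ?g = "\<lambda>x y. indicator X x * (indicator Y y * f (x, y))"
  have eq: "(\<lambda>z. indicator (X \<times> Y) z *\<^sub>R f z) = case_prod ?g"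
    by (auto simp: fun_eq_iff indicator_def)
  have int: "integrable (lborel \<Otimes>\<^sub>M lborel) (case_prod ?g)"
    using assms unfolding set_integrable_def eq lborel_prod .
  have L: "(LINT z:X \<times> Y|lborel. f z) = integral\<^sup>L (lborel \<Otimes>\<^sub>M lborel) (case_prod ?g)"
    unfolding set_lebesgue_integral_def eq lborel_prod ..
  show "AE x in lborel. x \<in> X \<longrightarrow> set_integrable lborel Y (\<lambda>y. f (x, y))"
    using lborel_pair.AE_integrable_fst[OF int]
    by eventually_elim (auto simp: set_integrable_def indicator_def)
  show "set_integrable lborel X (\<lambda>x. LINT y:Y|lborel. f (x, y))"
    using lborel_pair.integrable_fst[OF int]
    by (simp add: set_integrable_def set_lebesgue_integral_def)
  show "(LINT x:X|lborel. LINT y:Y|lborel. f (x, y)) = (LINT z:X \<times> Y|lborel. f z)"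
    using lborel_pair.integral_fst[OF int] unfolding L
    by (simp add: set_lebesgue_integral_def)
  have "(\<integral>y. \<integral>x. ?g x y \<partial>lborel \<partial>lborel) =
      (\<integral>y. indicator Y y * (\<integral>x. indicator X x * f (x, y) \<partial>lborel) \<partial>lborel)"
    by (simp add: mult.left_commute[of "indicator X _"])
  then show "(LINT y:Y|lborel. LINT x:X|lborel. f (x, y)) = (LINT z:X \<times> Y|lborel. f z)"
    using lborel_pair.integral_snd[OF int] unfolding L
    by (simp add: set_lebesgue_integral_def)
qed

section \<open>The fundamental theorem of calculus on products and the divergence theorem\<close>

lemma set_integral_FTC:
  fixes f :: "real \<Rightarrow> real"
  assumes "a \<le> b" "\<And>x. (f has_real_derivative f' x) (at x)" "continuous_on UNIV f'"
  shows "(LINT x:{a<..<b}|lborel. f' x) = f b - f a"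
proof -
  have "(LINT x:{a<..<b}|lborel. f' x) = (LINT x:{a..b}|lborel. f' x)"
    by (rule set_integral_discrete_difference[where X = "{a, b}"]) auto
  also have "\<dots> = f b - f a"
    using integral_FTC_Icc_real[of a b f f'] assms
    by (auto simp: set_lebesgue_integral_def mult.commute continuous_on_eq_continuous_at)
  finally show ?thesis .
qed

lemma set_integral_FTC_fst:
  fixes f :: "real \<times> 'b::euclidean_space \<Rightarrow> real"
  assumes "a \<le> b" "bounded S" "S \<in> sets borel"
    and der: "\<And>x s. ((\<lambda>x. f (x, s)) has_real_derivative f' (x, s)) (at x)"
    and cont: "continuous_on UNIV f'"
  shows "(LINT z:{a<..<b} \<times> S|lborel. f' z) = (LINT s:S|lborel. f (b, s) - f (a, s))"
proof -
  have "set_integrable lborel ({a<..<b} \<times> S) f'"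
    using assms by (intro set_integrable_continuous_bounded bounded_Times) (auto intro: borel_Times)
  from set_integral_Times_snd[OF this, symmetric]
  have "(LINT z:{a<..<b} \<times> S|lborel. f' z) = (LINT s:S|lborel. LINT x:{a<..<b}|lborel. f' (x, s))" .
  also have "\<dots> = (LINT s:S|lborel. f (b, s) - f (a, s))"
    by (subst set_integral_FTC[OF \<open>a \<le> b\<close> der])
      (auto intro!: continuous_on_compose2[OF cont] continuous_intros)
  finally show ?thesis .
qed

lemma set_integral_FTC_snd:
  fixes f :: "'b::euclidean_space \<times> real \<Rightarrow> real"
  assumes "a \<le> b" "bounded S" "S \<in> sets borel"
    and der: "\<And>s x. ((\<lambda>x. f (s, x)) has_real_derivative f' (s, x)) (at x)"
    and cont: "continuous_on UNIV f'"
  shows "(LINT z:S \<times> {a<..<b}|lborel. f' z) = (LINT s:S|lborel. f (s, b) - f (s, a))"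
proof -
  have "set_integrable lborel (S \<times> {a<..<b}) f'"
    using assms by (intro set_integrable_continuous_bounded bounded_Times) (auto intro: borel_Times)
  from set_integral_Times_fst[OF this, symmetric]
  have "(LINT z:S \<times> {a<..<b}|lborel. f' z) = (LINT s:S|lborel. LINT x:{a<..<b}|lborel. f' (s, x))" .
  also have "\<dots> = (LINT s:S|lborel. f (s, b) - f (s, a))"
    by (subst set_integral_FTC[OF \<open>a \<le> b\<close> der])
      (auto intro!: continuous_on_compose2[OF cont] continuous_intros)
  finally show ?thesis .
qed

lemma sets_Omega [measurable, simp]: "Omega L \<in> sets borel"
  by (simp add: Omega_def borel_Times)

lemma bounded_Omega [simp]: "bounded (Omega L)"
  by (simp add: Omega_def bounded_Times)

text \<open>Each of \<open>D0\<close>, \<open>D1\<close>, \<open>D2\<close> is integrated in its own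
  variable, with Fubini for the others. Continuity of \<open>G1\<close> and \<open>G2\<close> lets
  the iterated integrals over time and a side be rewritten over their product, the form in which the
  boundary traces converge.\<close>

lemma divergence_theorem_Omega:
  fixes G0 G1 G2 :: "real \<times> real \<times> real \<Rightarrow> real"
  assumes "0 \<le> T" "0 \<le> L"
    and der0: "\<And>t x y. ((\<lambda>t. G0 (t, x, y)) has_real_derivative D0 (t, x, y)) (at t)"
    and der1: "\<And>t x y. ((\<lambda>x. G1 (t, x, y)) has_real_derivative D1 (t, x, y)) (at x)"
    and der2: "\<And>t x y. ((\<lambda>y. G2 (t, x, y)) has_real_derivative D2 (t, x, y)) (at y)"
    and cont: "continuous_on UNIV G1" "continuous_on UNIV G2"
      "continuous_on UNIV D0" "continuous_on UNIV D1" "continuous_on UNIV D2"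
  shows "(LINT z:{0<..<T} \<times> Omega L|lborel. D0 z + D1 z + D2 z) =
      (LINT z:Omega L|lborel. G0 (T, z) - G0 (0, z))
    + (LINT z:{0<..<T} \<times> {0<..<1}|lborel. G1 (fst z, L, snd z) - G1 (fst z, 0, snd z))
    + (LINT z:{0<..<T} \<times> {0<..<L}|lborel. G2 (fst z, snd z, 1) - G2 (fst z, snd z, 0))"
proof -
  let ?Q = "{0<..<T} \<times> Omega L"
  have Q: "bounded ?Q" "?Q \<in> sets borel"
    by (auto intro: borel_Times bounded_Times)
  have int: "set_integrable lborel ?Q D0" "set_integrable lborel ?Q D1" "set_integrable lborel ?Q D2"
    using Q cont by (auto intro: set_integrable_continuous_bounded)
  have I0: "(LINT z:?Q|lborel. D0 z) = (LINT z:Omega L|lborel. G0 (T, z) - G0 (0, z))"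
    by (rule set_integral_FTC_fst) (use assms in auto)
  have "(LINT z:?Q|lborel. D1 z) = (LINT t:{0<..<T}|lborel. LINT z:Omega L|lborel. D1 (t, z))"
    using set_integral_Times_fst[OF int(2)] by simp
  also have "\<dots> = (LINT t:{0<..<T}|lborel. LINT y:{0<..<1}|lborel. G1 (t, L, y) - G1 (t, 0, y))"
    unfolding Omega_def using \<open>0 \<le> L\<close>
    by (subst set_integral_FTC_fst[OF _ _ _ der1])
      (auto intro!: continuous_on_compose2[OF cont(4)] continuous_intros)
  also have "\<dots> = (LINT z:{0<..<T} \<times> {0<..<1}|lborel. G1 (fst z, L, snd z) - G1 (fst z, 0, snd z))"
    by (subst set_integral_Times_fst[symmetric])
      (auto intro!: set_integrable_continuous_bounded bounded_Times borel_Times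
        continuous_intros continuous_on_compose2[OF cont(1)])
  finally have I1: "(LINT z:?Q|lborel. D1 z) = \<dots>" .
  have slice2: "(LINT z:{0<..<L} \<times> {0<..<1}|lborel. D2 (t, z)) =
      (LINT x:{0<..<L}|lborel. G2 (t, x, 1) - G2 (t, x, 0))" for t
    by (rule set_integral_FTC_snd[where f = "\<lambda>z. G2 (t, z)" and f' = "\<lambda>z. D2 (t, z)"])
      (auto intro!: continuous_on_compose2[OF cont(5)] continuous_intros der2)
  have "(LINT z:?Q|lborel. D2 z) = (LINT t:{0<..<T}|lborel. LINT z:Omega L|lborel. D2 (t, z))"
    using set_integral_Times_fst[OF int(3)] by simp
  also have "\<dots> = (LINT t:{0<..<T}|lborel. LINT x:{0<..<L}|lborel. G2 (t, x, 1) - G2 (t, x, 0))"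
    unfolding Omega_def using slice2 by simp
  also have "\<dots> = (LINT z:{0<..<T} \<times> {0<..<L}|lborel. G2 (fst z, snd z, 1) - G2 (fst z, snd z, 0))"
    by (subst set_integral_Times_fst[symmetric])
      (auto intro!: set_integrable_continuous_bounded bounded_Times borel_Times
        continuous_intros continuous_on_compose2[OF cont(2)])
  finally have I2: "(LINT z:?Q|lborel. D2 z) = \<dots>" .
  have "(LINT z:?Q|lborel. D0 z + D1 z + D2 z) =
      (LINT z:?Q|lborel. D0 z) + (LINT z:?Q|lborel. D1 z) + (LINT z:?Q|lborel. D2 z)"
    using int by simp
  then show ?thesis
    unfolding I0 I1 I2 .
qed


section \<open>Passage to the limit in quadratic forms\<close>

text \<open>On a product of compact balls \<open>f'\<close> is bounded, so \<open>f\<close> is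
  Lipschitz in \<open>t\<close> with one constant for all nearby \<open>z\<close>. The increment in
  \<open>t\<close> therefore vanishes uniformly in \<open>z\<close>, and the increment in
  \<open>z\<close> is needed at \<open>t0\<close> only.\<close>

lemma continuous_on_separately:
  fixes f :: "real \<Rightarrow> 'a::euclidean_space \<Rightarrow> 'b::euclidean_space"
  assumes der: "\<And>t z. ((\<lambda>t. f t z) has_vector_derivative f' t z) (at t)"
    and cont': "continuous_on UNIV (\<lambda>(t, z). f' t z)"
    and cont: "\<And>t. continuous_on UNIV (f t)"
  shows "continuous_on UNIV (\<lambda>(t, z). f t z)"
proof -
  have "isCont (\<lambda>(t, z). f t z) (t0, z0)" for t0 z0
  proof -
    let ?K = "cball t0 1 \<times> cball z0 1"
    have "compact ((\<lambda>(t, z). f' t z) ` ?K)"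
      by (intro compact_continuous_image continuous_on_subset[OF cont'] compact_Times) auto
    then obtain M where M: "\<And>t z. t \<in> cball t0 1 \<Longrightarrow> z \<in> cball z0 1 \<Longrightarrow> norm (f' t z) \<le> M"
      using compact_imp_bounded[of "(\<lambda>(t, z). f' t z) ` ?K"] unfolding bounded_iff by force
    have lip: "norm (f t z - f t0 z) \<le> M * norm (t - t0)"
      if "t \<in> cball t0 1" "z \<in> cball z0 1" for t z
    proof (rule differentiable_bound[where S = "cball t0 1" and f' = "\<lambda>t h. h *\<^sub>R f' t z"])
      show "((\<lambda>t. f t z) has_derivative (\<lambda>h. h *\<^sub>R f' s z)) (at s within cball t0 1)" for s
        using der[where t = s and z = z] has_derivative_at_withinI has_vector_derivative_def by blast
      show "onorm (\<lambda>h. h *\<^sub>R f' s z) \<le> M" if "s \<in> cball t0 1" for s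
        using M[OF that \<open>z \<in> _\<close>] by (intro onorm_le) (auto simp: mult.commute[of M] intro!: mult_left_mono)
    qed (use that in auto)
    have lim: "((\<lambda>w. f t0 (snd w)) \<longlongrightarrow> f t0 z0) (at (t0, z0))"
      using cont[of t0] unfolding continuous_on_eq_continuous_at[OF open_UNIV]
      by (intro isCont_tendsto_compose[of z0 "f t0"] tendsto_eq_intros) auto
    have "\<forall>\<^sub>F w in at (t0, z0). w \<in> ball (t0, z0) 1"
      by (intro eventually_at_in_open') auto
    then have "\<forall>\<^sub>F w in at (t0, z0). norm (f (fst w) (snd w) - f t0 (snd w)) \<le> M * norm (fst w - t0)"
    proof eventually_elim
      case (elim w)
      have "dist t0 (fst w) \<le> 1" "dist z0 (snd w) \<le> 1"
        using elim dist_fst_le[of "(t0, z0)" w] dist_snd_le[of "(t0, z0)" w] by auto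
      then show ?case by (intro lip) auto
    qed
    moreover have "((\<lambda>w. M * norm (fst w - t0)) \<longlongrightarrow> 0) (at (t0, z0))"
      by (auto intro!: tendsto_eq_intros)
    ultimately have "((\<lambda>w. f (fst w) (snd w) - f t0 (snd w)) \<longlongrightarrow> 0) (at (t0, z0))"
      by (rule Lim_null_comparison)
    from tendsto_add[OF lim this] have "((\<lambda>w. f (fst w) (snd w)) \<longlongrightarrow> f t0 z0) (at (t0, z0))"
      by simp
    then show ?thesis
      by (simp add: isCont_def case_prod_unfold)
  qed
  then show ?thesis
    by (simp add: continuous_on_eq_continuous_at)
qed

text \<open>\<open>C1_with_partials\<close> asserts joint continuity of the partial derivatives, not
  of the function itself. The latter follows by adding one variable at a time: first
  \<open>x\<close> to \<open>y\<close>, then \<open>t\<close> to the pair.\<close>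

lemma C1_with_partials_continuous:
  assumes "C1_with_partials \<Phi> \<Phi>t \<Phi>x \<Phi>y"
  shows "continuous_on UNIV (\<lambda>(t, x, y). \<Phi> t x y)"
proof -
  have dt: "((\<lambda>s. \<Phi> s x y) has_vector_derivative \<Phi>t t x y) (at t)"
    and dx: "((\<lambda>s. \<Phi> t s y) has_vector_derivative \<Phi>x t x y) (at x)"
    and dy: "((\<lambda>s. \<Phi> t x s) has_vector_derivative \<Phi>y t x y) (at y)"
    and ct: "continuous_on UNIV (\<lambda>(t, x, y). \<Phi>t t x y)"
    and cx: "continuous_on UNIV (\<lambda>(t, x, y). \<Phi>x t x y)" for t x y
    using assms by (auto simp: C1_with_partials_def)
  have "continuous_on UNIV (\<lambda>(x, y). \<Phi> t x y)" for t
  proof (rule continuous_on_separately)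
    show "((\<lambda>s. \<Phi> t s y) has_vector_derivative \<Phi>x t x y) (at x)" for x y
      by (rule dx)
    have "continuous_on UNIV ((\<lambda>(t, x, y). \<Phi>x t x y) \<circ> (\<lambda>z. (t, z)))"
      by (intro continuous_on_compose continuous_on_Pair continuous_on_const continuous_on_id
          continuous_on_subset[OF cx] subset_UNIV)
    then show "continuous_on UNIV (\<lambda>(x, y). \<Phi>x t x y)"
      by (simp only: comp_def prod.case)
    show "continuous_on UNIV (\<Phi> t x)" for x
      using dy by (auto simp: continuous_on_eq_continuous_at intro: has_vector_derivative_continuous)
  qed
  then have cont: "continuous_on UNIV (\<lambda>z. case z of (x, y) \<Rightarrow> \<Phi> t x y)" for t .
  have der: "((\<lambda>t. case z of (x, y) \<Rightarrow> \<Phi> t x y) has_vector_derivative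
      (case z of (x, y) \<Rightarrow> \<Phi>t t x y)) (at t)" for t z
    using dt by (cases z) simp
  show ?thesis
    by (rule continuous_on_separately[of "\<lambda>t z. case z of (x, y) \<Rightarrow> \<Phi> t x y", OF der ct cont])
qed

section \<open>From \<open>Lp\<close> convergence to convergence of integrals\<close>

text \<open>Takes the square root of a null sequence of extended values: the Cauchy-Schwarz
  inequality for nonnegative integrals bounds only the square of the mixed integral.\<close>

lemma tendsto_0_ennreal_power2:
  fixes f :: "'a \<Rightarrow> ennreal"
  assumes "((\<lambda>x. (f x)\<^sup>2) \<longlongrightarrow> 0) F"
  shows "(f \<longlongrightarrow> 0) F"
proof (rule order_tendstoI)
  fix e :: ennreal assume "0 < e"
  then have "0 < e\<^sup>2"
    by (metis zero_less_iff_neq_zero power_eq_0_iff)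
  then have "\<forall>\<^sub>F x in F. (f x)\<^sup>2 < e\<^sup>2"
    using assms order_tendstoD(2) by blast
  then show "\<forall>\<^sub>F x in F. f x < e"
    by eventually_elim (meson linorder_not_le power_mono zero_le)
qed auto

text \<open>Converts convergence in terms of extended nonnegative integrals into convergence of
  Bochner integrals. The bounded factor \<open>w\<close> will be the energy weight, with or without
  the exponential in time.\<close>

lemma Lp_tendsto_1_lebesgue_integral:
  fixes F :: "nat \<Rightarrow> 'a::euclidean_space \<Rightarrow> real"
  assumes lim: "Lp_tendsto 1 S F f"
    and w: "w \<in> borel_measurable borel" "\<And>z. z \<in> S \<Longrightarrow> \<bar>w z\<bar> \<le> K"
    and F: "\<And>n. set_integrable lborel S (F n)"
  shows Lp_tendsto_1_integrable: "set_integrable lborel S (\<lambda>z. w z * f z)"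
    and "(\<lambda>n. LINT z:S|lborel. w z * F n z) \<longlonglongrightarrow> (LINT z:S|lborel. w z * f z)"
proof -
  let ?g = "\<lambda>z. indicator S z *\<^sub>R (w z * f z)" and ?G = "\<lambda>n z. indicator S z *\<^sub>R (w z * F n z)"
  have f: "set_borel_measurable lborel S f" "(\<integral>\<^sup>+z\<in>S. ennreal \<bar>f z\<bar> \<partial>lborel) < \<infinity>"
    and conv: "(\<lambda>n. \<integral>\<^sup>+z\<in>S. ennreal \<bar>F n z - f z\<bar> \<partial>lborel) \<longlonglongrightarrow> 0"
    using lim by (auto simp: Lp_tendsto_def in_Lp_def)
  \<comment> \<open>\<open>K\<close> may be negative when \<open>S\<close> is empty, so its absolute
    value serves as the constant.\<close>
  have K: "\<bar>w z\<bar> \<le> \<bar>K\<bar>" if "z \<in> S" for z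
    using w(2)[OF that] by linarith
  have [measurable]: "w \<in> borel_measurable lborel"
    "(\<lambda>z. indicator S z * f z) \<in> borel_measurable lborel"
    "\<And>n. (\<lambda>z. indicator S z * F n z) \<in> borel_measurable lborel"
    using w f(1) borel_measurable_integrable[OF F[unfolded set_integrable_def]]
    by (simp_all add: set_borel_measurable_def)
  have "(\<lambda>z. w z * (indicator S z * f z)) \<in> borel_measurable lborel"
    "\<And>n. (\<lambda>z. w z * (indicator S z * F n z)) \<in> borel_measurable lborel"
    by measurable
  then have meas [measurable]: "?g \<in> borel_measurable lborel" "\<And>n. ?G n \<in> borel_measurable lborel"
    by (simp_all add: mult.left_commute)
  \<comment> \<open>Only the products with the indicator of \<open>S\<close> are known to be
    measurable, so both integrands are rewritten through them.\<close>
  have abs_meas: "(\<lambda>z. ennreal \<bar>f z\<bar> * indicator S z) \<in> borel_measurable lborel"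
    "\<And>n. (\<lambda>z. ennreal \<bar>F n z - f z\<bar> * indicator S z) \<in> borel_measurable lborel"
  proof -
    have "(\<lambda>z. ennreal \<bar>indicator S z * f z\<bar>) \<in> borel_measurable lborel"
      "(\<lambda>z. ennreal \<bar>indicator S z * F n z - indicator S z * f z\<bar>) \<in> borel_measurable lborel" for n
      by measurable
    moreover have "(\<lambda>z. ennreal \<bar>indicator S z * f z\<bar>) = (\<lambda>z. ennreal \<bar>f z\<bar> * indicator S z)"
      "(\<lambda>z. ennreal \<bar>indicator S z * F n z - indicator S z * f z\<bar>) =
        (\<lambda>z. ennreal \<bar>F n z - f z\<bar> * indicator S z)" for n
      by (auto simp: indicator_def fun_eq_iff)
    ultimately show "(\<lambda>z. ennreal \<bar>f z\<bar> * indicator S z) \<in> borel_measurable lborel"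
      "\<And>n. (\<lambda>z. ennreal \<bar>F n z - f z\<bar> * indicator S z) \<in> borel_measurable lborel"
      by auto
  qed
  have "(\<integral>\<^sup>+z. norm (?g z) \<partial>lborel) \<le> (\<integral>\<^sup>+z. ennreal \<bar>K\<bar> * (ennreal \<bar>f z\<bar> * indicator S z) \<partial>lborel)"
    by (intro nn_integral_mono)
      (auto simp: indicator_def abs_mult ennreal_mult[symmetric] intro!: mult_right_mono K)
  also have "\<dots> = ennreal \<bar>K\<bar> * (\<integral>\<^sup>+z\<in>S. ennreal \<bar>f z\<bar> \<partial>lborel)"
    using abs_meas by (simp add: nn_integral_cmult)
  also have "\<dots> < \<infinity>"
    using f(2) by (simp add: ennreal_mult_less_top)
  finally have int: "integrable lborel ?g"
    by (rule integrableI_bounded[OF meas(1)])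
  then show "set_integrable lborel S (\<lambda>z. w z * f z)"
    by (simp add: set_integrable_def)
  have "(\<lambda>n. \<integral>\<^sup>+z. norm (?G n z - ?g z) \<partial>lborel) \<longlonglongrightarrow> 0"
  proof (rule tendsto_sandwich[OF _ _ tendsto_const])
    have "(\<integral>\<^sup>+z. norm (?G n z - ?g z) \<partial>lborel)
        \<le> (\<integral>\<^sup>+z. ennreal \<bar>K\<bar> * (ennreal \<bar>F n z - f z\<bar> * indicator S z) \<partial>lborel)" for n
      by (intro nn_integral_mono)
        (auto simp: indicator_def abs_mult ennreal_mult[symmetric] right_diff_distrib[symmetric]
          intro!: mult_right_mono K)
    also have "\<dots> n = ennreal \<bar>K\<bar> * (\<integral>\<^sup>+z\<in>S. ennreal \<bar>F n z - f z\<bar> \<partial>lborel)" for n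
      using abs_meas by (simp add: nn_integral_cmult)
    finally show "\<forall>\<^sub>F n in sequentially. (\<integral>\<^sup>+z. norm (?G n z - ?g z) \<partial>lborel)
        \<le> ennreal \<bar>K\<bar> * (\<integral>\<^sup>+z\<in>S. ennreal \<bar>F n z - f z\<bar> \<partial>lborel)"
      by simp
    show "(\<lambda>n. ennreal \<bar>K\<bar> * (\<integral>\<^sup>+z\<in>S. ennreal \<bar>F n z - f z\<bar> \<partial>lborel)) \<longlonglongrightarrow> 0"
      using ennreal_tendsto_cmult[OF _ conv, of "ennreal \<bar>K\<bar>"] by simp
  qed auto
  moreover have "integrable lborel (?G n)" for n
  proof (rule Bochner_Integration.integrable_bound)
    show "integrable lborel (\<lambda>z. \<bar>K\<bar> * (indicator S z *\<^sub>R F n z))"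
      using F[of n] unfolding set_integrable_def by (rule integrable_mult_right)
    show "AE z in lborel. norm (?G n z) \<le> norm (\<bar>K\<bar> * (indicator S z *\<^sub>R F n z))"
      by (auto simp: indicator_def abs_mult intro!: mult_right_mono K)
  qed (rule meas)
  ultimately show "(\<lambda>n. LINT z:S|lborel. w z * F n z) \<longlonglongrightarrow> (LINT z:S|lborel. w z * f z)"
    unfolding set_lebesgue_integral_def
    by (intro tendsto_L1_int) (use int in auto)
qed

text \<open>The difference of the quadratic forms at \<open>u\<close> and \<open>v\<close> is at
  most a constant times the square of \<open>norm (u - v)\<close> plus
  \<open>2 * norm (u - v) * norm v\<close>. With \<open>v\<close> the limit, the mixed term tends to
  0 by Cauchy-Schwarz against a fixed square-integrable function.\<close>

lemma Lp_tendsto_2_quadratic_form: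
  fixes F :: "nat \<Rightarrow> 'a::euclidean_space \<Rightarrow> real^3" and M :: "real^3^3"
  assumes lim: "Lp_tendsto 2 S F f"
    and F: "\<And>n. set_borel_measurable lborel S (F n)"
  shows "Lp_tendsto 1 S (\<lambda>n z. F n z \<bullet> (M *v F n z)) (\<lambda>z. f z \<bullet> (M *v f z))"
proof -
  let ?f = "\<lambda>z. indicator S z *\<^sub>R f z" and ?F = "\<lambda>n z. indicator S z *\<^sub>R F n z"
  have f: "set_borel_measurable lborel S f" "(\<integral>\<^sup>+z\<in>S. ennreal (norm (f z) ^ 2) \<partial>lborel) < \<infinity>"
    and conv: "(\<lambda>n. \<integral>\<^sup>+z\<in>S. ennreal (norm (F n z - f z) ^ 2) \<partial>lborel) \<longlonglongrightarrow> 0"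
    using lim by (auto simp: Lp_tendsto_def in_Lp_def)
  have [measurable]: "?f \<in> borel_measurable lborel" "\<And>n. ?F n \<in> borel_measurable lborel"
    using f(1) F by (simp_all add: set_borel_measurable_def)
  have [measurable]: "(*v) M \<in> borel_measurable borel"
    by (intro borel_measurable_continuous_onI linear_continuous_on
        matrix_vector_mul_bounded_linear)
  obtain K where K: "K \<ge> 0" "\<And>v. norm (M *v v) \<le> norm v * K"
    using bounded_linear.nonneg_bounded[OF matrix_vector_mul_bounded_linear] by metis
  have quad: "\<bar>u \<bullet> (M *v u) - v \<bullet> (M *v v)\<bar> \<le> K * ((norm (u - v))\<^sup>2 + 2 * (norm (u - v) * norm v))"
    for u v :: "real^3"
  proof -
    have "u \<bullet> (M *v u) - v \<bullet> (M *v v) =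
        (u - v) \<bullet> (M *v (u - v)) + (u - v) \<bullet> (M *v v) + v \<bullet> (M *v (u - v))"
      by (simp add: inner_diff_left inner_diff_right matrix_vector_mult_diff_distrib)
    moreover have "\<bar>x \<bullet> (M *v y)\<bar> \<le> K * (norm x * norm y)" for x y
    proof -
      have "\<bar>x \<bullet> (M *v y)\<bar> \<le> norm x * (norm y * K)"
        using Cauchy_Schwarz_ineq2[of x "M *v y"] K(2)[of y]
        by (meson mult_left_mono norm_ge_zero order_trans)
      then show ?thesis
        by (simp add: mult_ac)
    qed
    note this[of "u - v" "u - v"] this[of "u - v" v] this[of v "u - v"]
    ultimately show ?thesis
      by (simp add: power2_eq_square algebra_simps)
  qed
  have norm_eq: "norm (?F n z - ?f z) = norm (F n z - f z) * indicator S z"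
    "norm (?f z) = norm (f z) * indicator S z" for n z
    by (auto simp: indicator_def)
  define d where "d n z = ennreal (norm (?F n z - ?f z))" for n z
  define e where "e z = ennreal (norm (?f z))" for z
  have [measurable]: "d n \<in> borel_measurable lborel" "e \<in> borel_measurable lborel" for n
    unfolding d_def e_def by measurable
  have d2: "(\<integral>\<^sup>+z. (d n z)\<^sup>2 \<partial>lborel) = (\<integral>\<^sup>+z\<in>S. ennreal (norm (F n z - f z) ^ 2) \<partial>lborel)" for n
    unfolding d_def by (intro nn_integral_cong) (simp add: indicator_def ennreal_power)
  have e2: "(\<integral>\<^sup>+z. (e z)\<^sup>2 \<partial>lborel) = (\<integral>\<^sup>+z\<in>S. ennreal (norm (f z) ^ 2) \<partial>lborel)"
    unfolding e_def by (intro nn_integral_cong) (simp add: indicator_def ennreal_power)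
  \<comment> \<open>Finiteness of the second factor excludes the product of 0 and infinity in the
    limit.\<close>
  have "(\<lambda>n. (\<integral>\<^sup>+z. (d n z)\<^sup>2 \<partial>lborel) * (\<integral>\<^sup>+z. (e z)\<^sup>2 \<partial>lborel)) \<longlonglongrightarrow> 0"
    using ennreal_tendsto_cmult[OF _ conv, of "\<integral>\<^sup>+z. (e z)\<^sup>2 \<partial>lborel"] f(2)
    by (simp add: d2 e2 mult.commute)
  then have "(\<lambda>n. (\<integral>\<^sup>+z. d n z * e z \<partial>lborel)\<^sup>2) \<longlonglongrightarrow> 0"
    by (rule tendsto_sandwich[OF _ _ tendsto_const, rotated 2])
      (auto intro!: always_eventually Cauchy_Schwarz_nn_integral)
  then have cross: "(\<lambda>n. \<integral>\<^sup>+z. d n z * e z \<partial>lborel) \<longlonglongrightarrow> 0"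
    by (rule tendsto_0_ennreal_power2)
  have "(\<lambda>n. \<integral>\<^sup>+z\<in>S. ennreal (norm (F n z \<bullet> (M *v F n z) - f z \<bullet> (M *v f z)) ^ 1) \<partial>lborel) \<longlonglongrightarrow> 0"
  proof (rule tendsto_sandwich[OF _ _ tendsto_const])
    have "(\<integral>\<^sup>+z\<in>S. ennreal (norm (F n z \<bullet> (M *v F n z) - f z \<bullet> (M *v f z)) ^ 1) \<partial>lborel)
        \<le> (\<integral>\<^sup>+z. ennreal K * ((d n z)\<^sup>2 + 2 * (d n z * e z)) \<partial>lborel)" for n
    proof (intro nn_integral_mono)
      fix z
      have "(d n z)\<^sup>2 + 2 * (d n z * e z) =
          ennreal ((norm (?F n z - ?f z))\<^sup>2 + 2 * (norm (?F n z - ?f z) * norm (?f z)))"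
        unfolding d_def e_def by (simp add: ennreal_power ennreal_mult')
      moreover have "ennreal (norm (F n z \<bullet> (M *v F n z) - f z \<bullet> (M *v f z)) ^ 1) * indicator S z
          \<le> ennreal (K * ((norm (?F n z - ?f z))\<^sup>2 + 2 * (norm (?F n z - ?f z) * norm (?f z))))"
        using quad[of "F n z" "f z"] by (cases "z \<in> S") (simp_all add: ennreal_leI)
      ultimately show "ennreal (norm (F n z \<bullet> (M *v F n z) - f z \<bullet> (M *v f z)) ^ 1) * indicator S z
          \<le> ennreal K * ((d n z)\<^sup>2 + 2 * (d n z * e z))"
        using K(1) by (simp only: ennreal_mult')
    qed
    also have "\<dots> n = ennreal K * ((\<integral>\<^sup>+z. (d n z)\<^sup>2 \<partial>lborel) + 2 * (\<integral>\<^sup>+z. d n z * e z \<partial>lborel))" for n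
      by (simp add: nn_integral_cmult nn_integral_add)
    finally show "\<forall>\<^sub>F n in sequentially.
        (\<integral>\<^sup>+z\<in>S. ennreal (norm (F n z \<bullet> (M *v F n z) - f z \<bullet> (M *v f z)) ^ 1) \<partial>lborel)
        \<le> ennreal K * ((\<integral>\<^sup>+z. (d n z)\<^sup>2 \<partial>lborel) + 2 * (\<integral>\<^sup>+z. d n z * e z \<partial>lborel))"
      by simp
    have "(\<lambda>n. (\<integral>\<^sup>+z. (d n z)\<^sup>2 \<partial>lborel) + 2 * (\<integral>\<^sup>+z. d n z * e z \<partial>lborel)) \<longlonglongrightarrow> 0 + 2 * 0"
      using conv cross unfolding d2 by (intro tendsto_add ennreal_tendsto_cmult) auto
    then show "(\<lambda>n. ennreal K * ((\<integral>\<^sup>+z. (d n z)\<^sup>2 \<partial>lborel) + 2 * (\<integral>\<^sup>+z. d n z * e z \<partial>lborel)))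
        \<longlonglongrightarrow> 0"
      using ennreal_tendsto_cmult[of "ennreal K" _ "0::ennreal"] by fastforce
  qed auto
  moreover have "set_borel_measurable lborel S (\<lambda>z. f z \<bullet> (M *v f z))"
  proof -
    have "(\<lambda>z. ?f z \<bullet> (M *v ?f z)) \<in> borel_measurable lborel"
      by measurable
    moreover have "(\<lambda>z. ?f z \<bullet> (M *v ?f z)) = (\<lambda>z. indicator S z *\<^sub>R (f z \<bullet> (M *v f z)))"
      by (auto simp: indicator_def)
    ultimately show ?thesis
      by (simp add: set_borel_measurable_def)
  qed
  moreover have "(\<integral>\<^sup>+z\<in>S. ennreal (norm (f z \<bullet> (M *v f z)) ^ 1) \<partial>lborel) < \<infinity>"
  proof -
    have "(\<integral>\<^sup>+z\<in>S. ennreal (norm (f z \<bullet> (M *v f z)) ^ 1) \<partial>lborel)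
        \<le> (\<integral>\<^sup>+z. ennreal K * (e z)\<^sup>2 \<partial>lborel)"
    proof (intro nn_integral_mono)
      fix z
      show "ennreal (norm (f z \<bullet> (M *v f z)) ^ 1) * indicator S z \<le> ennreal K * (e z)\<^sup>2"
        using quad[of "f z" 0] K(1)
        by (cases "z \<in> S") (simp_all add: e_def ennreal_power ennreal_mult[symmetric] ennreal_leI)
    qed
    also have "\<dots> = ennreal K * (\<integral>\<^sup>+z. (e z)\<^sup>2 \<partial>lborel)"
      by (simp add: nn_integral_cmult)
    also have "\<dots> < \<infinity>"
      using f(2) by (simp add: e2 ennreal_mult_less_top)
    finally show ?thesis .
  qed
  ultimately show ?thesis
    by (simp add: Lp_tendsto_def in_Lp_def)
qed


section \<open>The energy inequality for smooth functions\<close>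

lemma A1_mult: "A1 g H W *v u =
    vector [W * u $ 1 + sqrt (g * H) * u $ 2, sqrt (g * H) * u $ 1 + W * u $ 2, W * u $ 3]"
  by (simp add: vec_eq_iff forall_3 matrix_vector_mult_def sum_3 A1_def)

lemma A2_mult: "A2 g H *v u = vector [sqrt (g * H) * u $ 3, 0, sqrt (g * H) * u $ 1]"
  by (simp add: vec_eq_iff forall_3 matrix_vector_mult_def sum_3 A2_def)

lemma B_mult: "B k l *v u = vector [0, - k * u $ 2 + l * u $ 3, - l * u $ 2 - k * u $ 3]"
  by (simp add: vec_eq_iff forall_3 matrix_vector_mult_def sum_3 B_def)

lemma inner_3: "(u :: real^3) \<bullet> v = u $ 1 * v $ 1 + u $ 2 * v $ 2 + u $ 3 * v $ 3"
  by (simp add: inner_vec_def sum_3)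

lemma A1_quadratic:
  "u \<bullet> (A1 g H W *v u) = W * ((u $ 1)\<^sup>2 + (u $ 2)\<^sup>2 + (u $ 3)\<^sup>2) + 2 * sqrt (g * H) * u $ 1 * u $ 2"
  by (simp add: A1_mult inner_3 power2_eq_square algebra_simps)

lemma A2_quadratic: "u \<bullet> (A2 g H *v u) = 2 * sqrt (g * H) * u $ 1 * u $ 3"
  by (simp add: A2_mult inner_3)

text \<open>The Coriolis part is skew-symmetric and cancels; the drag alone dissipates, and it acts
  only on the velocities.\<close>

lemma B_quadratic: "u \<bullet> (B k l *v u) = - k * ((u $ 2)\<^sup>2 + (u $ 3)\<^sup>2)"
  by (simp add: B_mult inner_3 power2_eq_square algebra_simps)

lemma A1_symmetric: "u \<bullet> (A1 g H W *v v) = v \<bullet> (A1 g H W *v u)"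
  by (simp add: A1_mult inner_3 algebra_simps)

lemma A2_symmetric: "u \<bullet> (A2 g H *v v) = v \<bullet> (A2 g H *v u)"
  by (simp add: A2_mult inner_3 algebra_simps)

text \<open>Symmetry merges the two terms of the product rule. It is what makes the pairings of
  \<open>u\<close> with the flux terms of the system exact derivatives.\<close>

lemma has_real_derivative_quadratic_form:
  fixes A :: "real^3^3"
  assumes f: "(f has_vector_derivative f') (at x)"
    and sym: "\<And>u v. u \<bullet> (A *v v) = v \<bullet> (A *v u)"
  shows "((\<lambda>x. f x \<bullet> (A *v f x)) has_real_derivative 2 * (f x \<bullet> (A *v f'))) (at x)"
proof -
  have "((\<lambda>x. A *v f x) has_vector_derivative A *v f') (at x)"
    by (rule bounded_linear.has_vector_derivative[OF matrix_vector_mul_bounded_linear f])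
  from has_derivative_inner[OF f[unfolded has_vector_derivative_def] this[unfolded has_vector_derivative_def]]
  show ?thesis
    using sym[of f' "f x"]
    by (simp add: has_field_derivative_def algebra_simps inner_scaleR_right mult_commute_abs)
qed

section \<open>The pointwise energy estimate\<close>

text \<open>Here \<open>\<rho>\<close> stands for the weight \<open>2 * L - x\<close>, and the left
  side is the space-time divergence of the weighted energy without its exponential factor; the term
  with \<open>A1\<close> and no derivative of \<open>u\<close> comes from the slope -1 of the
  weight. Weight and drag together dissipate \<open>W / 2 * (u \<bullet> u)\<close>. One half of
  this pays for the growth of the exponential, the other for the residual \<open>r\<close>.\<close>

lemma energy_density_bound:
  fixes g k l H W L \<rho> :: real and u ut ux uy :: "real^3"
  assumes "0 < W" "0 < k" "L > 0" "L \<ge> (sqrt (g * H))\<^sup>2 / (k * W)" "L \<le> \<rho>" "\<rho> \<le> 2 * L"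
  defines "r \<equiv> ut + A1 g H W *v ux + A2 g H *v uy - B k l *v u"
  shows "\<rho> * (W / (8 * L) * (u \<bullet> u) + 2 * (u \<bullet> ut)) - u \<bullet> (A1 g H W *v u)
      + 2 * \<rho> * (u \<bullet> (A1 g H W *v ux)) + 2 * \<rho> * (u \<bullet> (A2 g H *v uy))
    \<le> 16 * L\<^sup>2 / W * (r \<bullet> r)"
proof -
  define c where "c = sqrt (g * H)"
  have "2 * \<rho> * (u \<bullet> r) = 2 * \<rho> * (u \<bullet> ut) + 2 * \<rho> * (u \<bullet> (A1 g H W *v ux))
      + 2 * \<rho> * (u \<bullet> (A2 g H *v uy)) + 2 * \<rho> * k * ((u $ 2)\<^sup>2 + (u $ 3)\<^sup>2)"
    by (simp add: r_def inner_add_right inner_diff_right B_quadratic algebra_simps)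
  moreover have "2 * \<rho> * (u \<bullet> r) \<le> W / 4 * (u \<bullet> u) + 16 * L\<^sup>2 / W * (r \<bullet> r)"
  proof -
    \<comment> \<open>Young's inequality, scaled so that exactly
      \<open>W / 4 * (u \<bullet> u)\<close> is spent; the residual constant then follows from
      \<open>\<rho> \<le> 2 * L\<close>.\<close>
    have "0 \<le> ((W / 4) *\<^sub>R u - \<rho> *\<^sub>R r) \<bullet> ((W / 4) *\<^sub>R u - \<rho> *\<^sub>R r) * (4 / W)"
      using \<open>0 < W\<close> by (intro mult_nonneg_nonneg) auto
    also have "\<dots> = W / 4 * (u \<bullet> u) - 2 * \<rho> * (u \<bullet> r) + 4 * \<rho>\<^sup>2 / W * (r \<bullet> r)"
      using \<open>0 < W\<close>
      by (simp add: inner_diff_left inner_diff_right inner_commute[of r u] field_simps power2_eq_square)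
    finally have "2 * \<rho> * (u \<bullet> r) \<le> W / 4 * (u \<bullet> u) + 4 * \<rho>\<^sup>2 / W * (r \<bullet> r)"
      by simp
    moreover have "\<rho>\<^sup>2 \<le> (2 * L)\<^sup>2"
      using assms by (intro power_mono) auto
    then have "4 * \<rho>\<^sup>2 / W * (r \<bullet> r) \<le> 16 * L\<^sup>2 / W * (r \<bullet> r)"
      using \<open>0 < W\<close> by (intro mult_right_mono divide_right_mono) (auto simp: power2_eq_square)
    ultimately show ?thesis by linarith
  qed
  moreover have "\<rho> * (W / (8 * L) * (u \<bullet> u)) \<le> W / 4 * (u \<bullet> u)"
  proof -
    \<comment> \<open>The rate \<open>W / (8 * L)\<close> is the largest for which the weight bound
      \<open>2 * L\<close> costs no more than \<open>W / 4\<close>.\<close>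
    have "\<rho> * (W / (8 * L)) \<le> 2 * L * (W / (8 * L))"
      using assms by (intro mult_right_mono) auto
    also have "\<dots> = W / 4"
      using \<open>L > 0\<close> by simp
    finally show ?thesis
      by (metis inner_ge_zero mult.assoc mult_right_mono)
  qed
  moreover have "W / 2 * (u \<bullet> u) \<le> u \<bullet> (A1 g H W *v u) + 2 * \<rho> * k * ((u $ 2)\<^sup>2 + (u $ 3)\<^sup>2)"
  proof -
    \<comment> \<open>The lower bound on \<open>L\<close> enters here: the drag supplies the square
      of \<open>u $ 2\<close> that completes the square with half of the \<open>u $ 1\<close> term
      and the cross term of \<open>A1\<close>.\<close>
    have "c\<^sup>2 / W \<le> L * k"
      using assms by (simp add: c_def field_simps)
    also have "\<dots> \<le> \<rho> * k"
      using assms by simp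
    finally have "2 * (c\<^sup>2 / W) * (u $ 2)\<^sup>2 \<le> 2 * \<rho> * k * (u $ 2)\<^sup>2"
      by (intro mult_right_mono) auto
    moreover have "0 \<le> W / 2 * (u $ 1 + 2 * c * u $ 2 / W)\<^sup>2"
      using \<open>0 < W\<close> by simp
    moreover have "W / 2 * (u $ 1 + 2 * c * u $ 2 / W)\<^sup>2
        = W / 2 * (u $ 1)\<^sup>2 + 2 * c * u $ 1 * u $ 2 + 2 * (c\<^sup>2 / W) * (u $ 2)\<^sup>2"
      using \<open>0 < W\<close> by (simp add: field_simps power2_eq_square)
    moreover have "0 \<le> 2 * \<rho> * k * (u $ 3)\<^sup>2" "0 \<le> W / 2 * (u $ 2)\<^sup>2" "0 \<le> W / 2 * (u $ 3)\<^sup>2"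
      using assms by simp_all
    moreover have "u \<bullet> u = (u $ 1)\<^sup>2 + (u $ 2)\<^sup>2 + (u $ 3)\<^sup>2"
      by (simp add: inner_3 power2_eq_square)
    ultimately show ?thesis
      unfolding A1_quadratic c_def[symmetric] by (simp add: algebra_simps)
  qed
  ultimately show ?thesis
    by (simp add: algebra_simps)
qed

section \<open>The weighted boundary flux and the integrated energy inequality\<close>

definition bottom :: "real \<Rightarrow> real set" where
  "bottom L = wall0 L \<union> spillway L"

lemma sets_bottom [measurable, simp]:
  "bottom L \<in> sets borel" "wall0 L \<in> sets borel" "spillway L \<in> sets borel"
  by (auto simp: bottom_def wall0_def spillway_def)

lemma bounded_bottom [simp]: "bounded (bottom L)" "bounded (wall0 L)" "bounded (spillway L)"
  by (auto simp: bottom_def wall0_def spillway_def)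

lemma set_integral_bottom:
  assumes "L > 0"
  shows "(LINT x:bottom L|lborel. f x) = (LINT x:{0<..<L}|lborel. (f x :: real))"
  by (rule set_integral_discrete_difference[where X = "{L/3, 2*L/3}"])
    (use assms in \<open>auto simp: bottom_def wall0_def spillway_def\<close>)

text \<open>
  The lower side is taken without the points \<open>L/3\<close>, \<open>2L/3\<close>: nothing makes \<open>U t x 0\<close>
  measurable in \<open>t\<close> there, and \<^const>\<open>lborel\<close> is not complete.
\<close>

definition boundary_flux ::
  "real \<Rightarrow> real \<Rightarrow> real \<Rightarrow> real \<Rightarrow> real \<Rightarrow> real \<Rightarrow> (real \<Rightarrow> real \<Rightarrow> real \<Rightarrow> real^3) \<Rightarrow> real" where
  "boundary_flux g H W L a T U =
     (LINT z:{0<..<T} \<times> {0<..<1}|lborel.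
        (exp (a * fst z) * L) * (U (fst z) L (snd z) \<bullet> (A1 g H W *v U (fst z) L (snd z))))
   - (LINT z:{0<..<T} \<times> {0<..<1}|lborel.
        (exp (a * fst z) * (2 * L)) * (U (fst z) 0 (snd z) \<bullet> (A1 g H W *v U (fst z) 0 (snd z))))
   + (LINT z:{0<..<T} \<times> {0<..<L}|lborel.
        (exp (a * fst z) * (2 * L - snd z)) * (U (fst z) (snd z) 1 \<bullet> (A2 g H *v U (fst z) (snd z) 1)))
   - (LINT z:{0<..<T} \<times> bottom L|lborel.
        (exp (a * fst z) * (2 * L - snd z)) * (U (fst z) (snd z) 0 \<bullet> (A2 g H *v U (fst z) (snd z) 0)))"

text \<open>The divergence theorem, applied to the weighted energy and its two fluxes, integrates
  the pointwise bound. \<open>\<Phi>\<close> is an arbitrary smooth function: its failure to solve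
  the system is carried by \<open>R\<close>, and its boundary values stay inside
  \<open>boundary_flux\<close>.\<close>

lemma energy_inequality:
  fixes g k l H W L T :: real
  assumes "0 < W" "0 < k" "L > 0" "L \<ge> (sqrt (g * H))\<^sup>2 / (k * W)" "0 \<le> T"
    and C1: "C1_with_partials \<Phi> \<Phi>t \<Phi>x \<Phi>y"
  defines "R \<equiv> \<lambda>(t, x, y). \<Phi>t t x y + A1 g H W *v \<Phi>x t x y + A2 g H *v \<Phi>y t x y - B k l *v \<Phi> t x y"
  shows "exp (W / (8 * L) * T) * (LINT z:Omega L|lborel. (2 * L - fst z) * (\<Phi> T (fst z) (snd z) \<bullet> \<Phi> T (fst z) (snd z)))
      - (LINT z:Omega L|lborel. (2 * L - fst z) * (\<Phi> 0 (fst z) (snd z) \<bullet> \<Phi> 0 (fst z) (snd z)))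
      + boundary_flux g H W L (W / (8 * L)) T \<Phi>
    \<le> exp (W / (8 * L) * T) * (16 * L\<^sup>2 / W) * (LINT z:{0<..<T} \<times> Omega L|lborel. R z \<bullet> R z)"
proof -
  define a where "a = W / (8 * L)"
  have "0 < a"
    using assms by (simp add: a_def)
  let ?A1 = "A1 g H W" and ?A2 = "A2 g H"
  define P where "P = (\<lambda>(t, x, y). \<Phi> t x y)"
  define Pt where "Pt = (\<lambda>(t, x, y). \<Phi>t t x y)"
  define Px where "Px = (\<lambda>(t, x, y). \<Phi>x t x y)"
  define Py where "Py = (\<lambda>(t, x, y). \<Phi>y t x y)"
  define wt where "wt z = exp (a * fst z) * (2 * L - fst (snd z))" for z :: "real \<times> real \<times> real"
  define G0 where "G0 z = wt z * (P z \<bullet> P z)" for z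
  define G1 where "G1 z = wt z * (P z \<bullet> (?A1 *v P z))" for z
  define G2 where "G2 z = wt z * (P z \<bullet> (?A2 *v P z))" for z
  define D0 where "D0 z = wt z * (a * (P z \<bullet> P z) + 2 * (P z \<bullet> Pt z))" for z
  define D1 where "D1 z = - exp (a * fst z) * (P z \<bullet> (?A1 *v P z)) + wt z * (2 * (P z \<bullet> (?A1 *v Px z)))" for z
  define D2 where "D2 z = wt z * (2 * (P z \<bullet> (?A2 *v Py z)))" for z
  have R: "R z = Pt z + ?A1 *v Px z + ?A2 *v Py z - B k l *v P z" for z
    by (simp add: R_def Pt_def Px_def Py_def P_def case_prod_unfold)
  have cont [continuous_intros]: "continuous_on UNIV P" "continuous_on UNIV Pt"
    "continuous_on UNIV Px" "continuous_on UNIV Py" "continuous_on UNIV wt"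
    using C1 C1_with_partials_continuous[OF C1]
    by (auto simp: C1_with_partials_def P_def Pt_def Px_def Py_def wt_def intro!: continuous_intros)
  have mat [continuous_intros]: "continuous_on UNIV f \<Longrightarrow> continuous_on UNIV (\<lambda>z. A *v f z)"
    for f :: "real \<times> real \<times> real \<Rightarrow> real^3" and A :: "real^3^3"
    by (rule bounded_linear.continuous_on[OF matrix_vector_mul_bounded_linear])
  have contR: "continuous_on UNIV R"
    unfolding R[abs_def] by (intro continuous_intros)
  have contG: "continuous_on UNIV G0" "continuous_on UNIV G1" "continuous_on UNIV G2"
    "continuous_on UNIV D0" "continuous_on UNIV D1" "continuous_on UNIV D2"
    unfolding G0_def[abs_def] G1_def[abs_def] G2_def[abs_def] D0_def[abs_def] D1_def[abs_def] D2_def[abs_def]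
    by (intro continuous_intros)+
  have dt: "((\<lambda>t. P (t, x, y)) has_vector_derivative Pt (t, x, y)) (at t)"
    and dx: "((\<lambda>x. P (t, x, y)) has_vector_derivative Px (t, x, y)) (at x)"
    and dy: "((\<lambda>y. P (t, x, y)) has_vector_derivative Py (t, x, y)) (at y)" for t x y
    using C1 by (simp_all add: C1_with_partials_def P_def Pt_def Px_def Py_def)
  \<comment> \<open>The identity matrix brings the energy density itself under the rule for
    quadratic forms.\<close>
  have "((\<lambda>t. P (t, x, y) \<bullet> (mat 1 *v P (t, x, y))) has_real_derivative
      2 * (P (t, x, y) \<bullet> (mat 1 *v Pt (t, x, y)))) (at t)" for t x y
    by (rule has_real_derivative_quadratic_form[OF dt]) (simp add: inner_commute)
  then have q0: "((\<lambda>t. P (t, x, y) \<bullet> P (t, x, y)) has_real_derivative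
      2 * (P (t, x, y) \<bullet> Pt (t, x, y))) (at t)" for t x y
    by simp
  note q1 = has_real_derivative_quadratic_form[OF dx A1_symmetric]
  note q2 = has_real_derivative_quadratic_form[OF dy A2_symmetric]
  have d0: "((\<lambda>t. G0 (t, x, y)) has_real_derivative D0 (t, x, y)) (at t)" for t x y
    unfolding G0_def D0_def wt_def fst_conv snd_conv
    by (rule derivative_eq_intros q0 refl)+ (simp add: algebra_simps)
  have d1: "((\<lambda>x. G1 (t, x, y)) has_real_derivative D1 (t, x, y)) (at x)" for t x y
    unfolding G1_def D1_def wt_def fst_conv snd_conv
    by (rule derivative_eq_intros q1 refl)+ (simp add: algebra_simps)
  have d2: "((\<lambda>y. G2 (t, x, y)) has_real_derivative D2 (t, x, y)) (at y)" for t x y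
    unfolding G2_def D2_def wt_def fst_conv snd_conv
    by (rule derivative_eq_intros q2 refl)+ (simp add: algebra_simps)
  note div = divergence_theorem_Omega[OF \<open>0 \<le> T\<close> _ d0 d1 d2 contG(2-6), of L]
  have int: "set_integrable lborel ({0<..<T} \<times> Omega L) f"
    if "continuous_on UNIV f" for f :: "real \<times> real \<times> real \<Rightarrow> real"
    using that by (intro set_integrable_continuous_bounded) (auto intro: bounded_Times borel_Times)
  have bound: "D0 z + D1 z + D2 z \<le> exp (a * T) * (16 * L\<^sup>2 / W) * (R z \<bullet> R z)"
    if "z \<in> {0<..<T} \<times> Omega L" for z
  proof -
    obtain t x y where z: "z = (t, x, y)" by (cases z)
    have tx: "0 < t" "t < T" "0 < x" "x < L"
      using that by (auto simp: z Omega_def)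
    have "D0 z + D1 z + D2 z = exp (a * t) * ((2 * L - x) * (a * (P z \<bullet> P z) + 2 * (P z \<bullet> Pt z))
        - P z \<bullet> (A1 g H W *v P z) + 2 * (2 * L - x) * (P z \<bullet> (A1 g H W *v Px z))
        + 2 * (2 * L - x) * (P z \<bullet> (A2 g H *v Py z)))"
      by (simp add: D0_def D1_def D2_def wt_def z algebra_simps)
    also have "\<dots> \<le> exp (a * t) * (16 * L\<^sup>2 / W * (R z \<bullet> R z))"
      unfolding R a_def using assms tx by (intro mult_left_mono energy_density_bound) auto
    also have "\<dots> \<le> exp (a * T) * (16 * L\<^sup>2 / W * (R z \<bullet> R z))"
      using assms tx \<open>0 < a\<close> by (intro mult_right_mono) auto
    finally show ?thesis by (simp add: mult.assoc)
  qed
  have "(LINT z:{0<..<T} \<times> Omega L|lborel. D0 z + D1 z + D2 z)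
      \<le> (LINT z:{0<..<T} \<times> Omega L|lborel. exp (a * T) * (16 * L\<^sup>2 / W) * (R z \<bullet> R z))"
    by (intro set_integral_mono int bound continuous_intros contG contR)
  also have "\<dots> = exp (a * T) * (16 * L\<^sup>2 / W) * (LINT z:{0<..<T} \<times> Omega L|lborel. R z \<bullet> R z)"
    by simp
  finally have main: "(LINT z:{0<..<T} \<times> Omega L|lborel. D0 z + D1 z + D2 z) \<le> \<dots>" .
  have intO: "set_integrable lborel (Omega L) (\<lambda>z. G0 (t, z))" for t
    by (intro set_integrable_continuous_bounded continuous_on_compose2[OF contG(1)] continuous_intros) auto
  have int1: "set_integrable lborel ({0<..<T} \<times> {0<..<1}) (\<lambda>z. G1 (fst z, x, snd z))" for x
    by (intro set_integrable_continuous_bounded continuous_on_compose2[OF contG(2)] continuous_intros)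
      (auto intro: bounded_Times borel_Times)
  have int2: "set_integrable lborel ({0<..<T} \<times> {0<..<L}) (\<lambda>z. G2 (fst z, snd z, y))" for y
    by (intro set_integrable_continuous_bounded continuous_on_compose2[OF contG(3)] continuous_intros)
      (auto intro: bounded_Times borel_Times)
  \<comment> \<open>For each fixed time, removing the two end points of the spillway does not change
    the integral over \<open>x\<close>; Fubini transfers this to the product.\<close>
  have bot: "(LINT z:{0<..<T} \<times> {0<..<L}|lborel. G2 (fst z, snd z, 0)) =
      (LINT z:{0<..<T} \<times> bottom L|lborel. G2 (fst z, snd z, 0))"
  proof -
    have "set_integrable lborel ({0<..<T} \<times> bottom L) (\<lambda>z. G2 (fst z, snd z, 0))"
      by (intro set_integrable_continuous_bounded continuous_on_compose2[OF contG(3)] continuous_intros)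
        (auto intro: bounded_Times borel_Times)
    from set_integral_Times_fst[OF this] set_integral_Times_fst[OF int2[of 0]]
    show ?thesis
      by (simp add: set_integral_bottom[OF \<open>L > 0\<close>])
  qed
  have E: "(LINT z:Omega L|lborel. G0 (t, z)) = exp (a * t) *
      (LINT z:Omega L|lborel. (2 * L - fst z) * (\<Phi> t (fst z) (snd z) \<bullet> \<Phi> t (fst z) (snd z)))" for t
    by (simp add: G0_def wt_def P_def case_prod_unfold mult.assoc)
  have "(LINT z:{0<..<T} \<times> Omega L|lborel. D0 z + D1 z + D2 z) =
      exp (a * T) * (LINT z:Omega L|lborel. (2 * L - fst z) * (\<Phi> T (fst z) (snd z) \<bullet> \<Phi> T (fst z) (snd z)))
      - (LINT z:Omega L|lborel. (2 * L - fst z) * (\<Phi> 0 (fst z) (snd z) \<bullet> \<Phi> 0 (fst z) (snd z)))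
      + boundary_flux g H W L a T \<Phi>"
    using div \<open>L > 0\<close> E[of T] E[of 0]
    unfolding set_integral_diff(2)[OF intO intO] set_integral_diff(2)[OF int1 int1]
      set_integral_diff(2)[OF int2 int2] bot
    by (simp add: boundary_flux_def G1_def G2_def wt_def P_def)
  then show ?thesis
    using main unfolding a_def by simp
qed


section \<open>Convergence of the boundary flux\<close>

text \<open>
  \<open>M\<close> expresses the flux density through the conormal trace \<open>A u\<close>. It exists also for the singular
  matrix \<open>A2\<close>, whose flux density involves only the components that \<open>A2\<close> retains.
\<close>

lemma conormal_trace_tendsto:
  fixes F :: "nat \<Rightarrow> 'a::euclidean_space \<Rightarrow> real^3" and A M :: "real^3^3"
  assumes M: "\<And>u. (A *v u) \<bullet> (M *v (A *v u)) = u \<bullet> (A *v u)"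
    and lim: "Lp_tendsto 2 S (\<lambda>n z. A *v F n z) (\<lambda>z. A *v f z)"
    and w: "w \<in> borel_measurable borel" "\<And>z. z \<in> S \<Longrightarrow> \<bar>w z\<bar> \<le> K"
    and F: "\<And>n. continuous_on UNIV (F n)"
    and S: "bounded S" "S \<in> sets borel"
  shows conormal_trace_integrable: "set_integrable lborel S (\<lambda>z. w z * (f z \<bullet> (A *v f z)))"
    and "(\<lambda>n. LINT z:S|lborel. w z * (F n z \<bullet> (A *v F n z)))
      \<longlonglongrightarrow> (LINT z:S|lborel. w z * (f z \<bullet> (A *v f z)))"
proof -
  have cont: "continuous_on UNIV (\<lambda>z. A *v F n z)" for n
    by (rule bounded_linear.continuous_on[OF matrix_vector_mul_bounded_linear F])
  have "set_borel_measurable lborel S (\<lambda>z. A *v F n z)" for n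
    unfolding set_borel_measurable_def
    using borel_measurable_continuous_onI[OF cont[of n]] S(2)
    by (auto intro!: borel_measurable_scaleR)
  \<comment> \<open>The quadratic form of \<open>M\<close> is evaluated on the converging sequence
    \<open>A *v F n z\<close>; the hypothesis on \<open>M\<close> turns it back into the flux
    density.\<close>
  from Lp_tendsto_2_quadratic_form[OF lim this, of M]
  have 1: "Lp_tendsto 1 S (\<lambda>n z. F n z \<bullet> (A *v F n z)) (\<lambda>z. f z \<bullet> (A *v f z))"
    by (simp add: M)
  have 2: "set_integrable lborel S (\<lambda>z. F n z \<bullet> (A *v F n z))" for n
    by (intro set_integrable_continuous_bounded continuous_on_inner F cont S)
  show "set_integrable lborel S (\<lambda>z. w z * (f z \<bullet> (A *v f z)))"
    "(\<lambda>n. LINT z:S|lborel. w z * (F n z \<bullet> (A *v F n z)))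
      \<longlonglongrightarrow> (LINT z:S|lborel. w z * (f z \<bullet> (A *v f z)))"
    using Lp_tendsto_1_integrable[OF 1 w 2] Lp_tendsto_1_lebesgue_integral(2)[OF 1 w 2] by auto
qed

text \<open>Subcritical flow makes \<open>W\<^sup>2 - c\<^sup>2\<close> nonzero, so
  \<open>A1\<close> is invertible and its conormal trace determines all components on the gates.
  \<open>M\<close> is the explicit inverse.\<close>

lemma A1_left_inverse:
  assumes "0 < W" "W < sqrt (g * H)"
  obtains M :: "real^3^3" where "\<And>u. M *v (A1 g H W *v u) = u"
proof -
  define c where "c = sqrt (g * H)"
  define d where "d = W\<^sup>2 - c\<^sup>2"
  have "W\<^sup>2 < c\<^sup>2"
    using assms by (simp add: c_def power_strict_mono)
  then have d: "d \<noteq> 0" by (simp add: d_def)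
  define M :: "real^3^3" where "M = vector [vector [W / d, - c / d, 0], vector [- c / d, W / d, 0], vector [0, 0, 1 / W]]"
  have *: "W * (W * x + c * y) / d - c * (c * x + W * y) / d = x"
    "W * (c * x + W * y) / d - c * (W * x + c * y) / d = y" for x y
    using d by (simp_all add: field_simps) (simp_all add: d_def power2_eq_square algebra_simps)
  have "M *v (A1 g H W *v u) = u" for u
    using *[of "u $ 1" "u $ 2"] \<open>0 < W\<close> unfolding A1_mult c_def[symmetric]
    by (simp add: M_def vec_eq_iff forall_3 matrix_vector_mult_def sum_3)
  then show ?thesis by (rule that)
qed

text \<open>These are the four integrands of \<open>boundary_flux\<close>. Integrability on the
  products yields, by Fubini, both integrability of almost every time slice for the sign of
  \<open>BC\<close> and the time integral in \<open>boundary_flux_eq\<close>.\<close>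

definition traces_integrable ::
  "real \<Rightarrow> real \<Rightarrow> real \<Rightarrow> real \<Rightarrow> real \<Rightarrow> real \<Rightarrow> (real \<Rightarrow> real \<Rightarrow> real \<Rightarrow> real^3) \<Rightarrow> bool" where
  "traces_integrable g H W L a T U \<longleftrightarrow>
     set_integrable lborel ({0<..<T} \<times> {0<..<1})
       (\<lambda>z. (exp (a * fst z) * L) * (U (fst z) L (snd z) \<bullet> (A1 g H W *v U (fst z) L (snd z)))) \<and>
     set_integrable lborel ({0<..<T} \<times> {0<..<1})
       (\<lambda>z. (exp (a * fst z) * (2 * L)) * (U (fst z) 0 (snd z) \<bullet> (A1 g H W *v U (fst z) 0 (snd z)))) \<and>
     set_integrable lborel ({0<..<T} \<times> {0<..<L})
       (\<lambda>z. (exp (a * fst z) * (2 * L - snd z)) * (U (fst z) (snd z) 1 \<bullet> (A2 g H *v U (fst z) (snd z) 1))) \<and>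
     set_integrable lborel ({0<..<T} \<times> bottom L)
       (\<lambda>z. (exp (a * fst z) * (2 * L - snd z)) * (U (fst z) (snd z) 0 \<bullet> (A2 g H *v U (fst z) (snd z) 0)))"

text \<open>On the gates and the spillway the conormal traces converge in \<open>L2\<close>, hence
  their quadratic forms in \<open>L1\<close>; on the solid walls \<open>L1\<close> convergence of
  the flux density is part of \<open>wall_trace_tendsto\<close>. The lower side combines both modes
  along the disjoint union of walls and spillway.\<close>

lemma boundary_flux_tendsto:
  fixes g H W L T a :: real
  assumes "0 < W" "W < sqrt (g * H)" "0 < L" "0 \<le> a"
    and cont: "\<And>n. continuous_on UNIV (\<lambda>(t, x, y). \<Phi> n t x y)"
    and tr: "traces_tendsto g H W L T \<Phi> U"
  shows traces_tendsto_integrable: "traces_integrable g H W L a T U"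
    and "(\<lambda>n. boundary_flux g H W L a T (\<Phi> n)) \<longlonglongrightarrow> boundary_flux g H W L a T U"
proof -
  \<comment> \<open>A common bound on \<open>{0<..<T}\<close> for the weights on all four
    sides.\<close>
  define K where "K = exp (a * T) * (2 * L)"
  have ex: "exp (a * t) * x \<le> K" if "t < T" "0 < x" "x \<le> 2 * L" for t x
    unfolding K_def using assms that by (intro mult_mono) (auto intro: mult_left_mono)
  define w where "w z = exp (a * fst z) * (2 * L - snd z)" for z :: "real \<times> real"
  have w: "w \<in> borel_measurable borel" unfolding w_def
    by (intro borel_measurable_continuous_onI continuous_intros)
  have wK: "\<bar>w z\<bar> \<le> K" if "z \<in> {0<..<T} \<times> {0<..<L}" for z
    using that ex[of "fst z" "2 * L - snd z"] by (auto simp: w_def abs_mult)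
  have bot: "{0<..<T} \<times> wall0 L \<subseteq> {0<..<T} \<times> {0<..<L}" "{0<..<T} \<times> spillway L \<subseteq> {0<..<T} \<times> {0<..<L}"
    using \<open>0 < L\<close> by (auto simp: wall0_def spillway_def)
  have S: "bounded ({0<..<T} \<times> X)" "{0<..<T} \<times> X \<in> sets borel"
    if "bounded X" "X \<in> sets borel" for X :: "real set"
    using that by (auto intro: bounded_Times borel_Times)
  have contx: "continuous_on UNIV (\<lambda>z. \<Phi> n (fst z) x (snd z))"
    and conty: "continuous_on UNIV (\<lambda>z. \<Phi> n (fst z) (snd z) x)" for n x
  proof -
    have "continuous_on UNIV (\<lambda>z::real \<times> real. (fst z, x, snd z))" "continuous_on UNIV (\<lambda>z::real \<times> real. (fst z, snd z, x))"
      by (intro continuous_intros)+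
    from continuous_on_compose2[OF cont this(1) subset_UNIV, of n]
      continuous_on_compose2[OF cont this(2) subset_UNIV, of n]
    show "continuous_on UNIV (\<lambda>z. \<Phi> n (fst z) x (snd z))" "continuous_on UNIV (\<lambda>z. \<Phi> n (fst z) (snd z) x)"
      by simp_all
  qed
  note tr' = tr[unfolded traces_tendsto_def wall_trace_tendsto_def case_prod_unfold]
  obtain M where M: "\<And>u. M *v (A1 g H W *v u) = u"
    using A1_left_inverse assms(1,2) by blast
  have M1: "(A1 g H W *v u) \<bullet> (M *v (A1 g H W *v u)) = u \<bullet> (A1 g H W *v u)" for u
    by (simp add: M inner_commute)
  have "sqrt (g * H) \<noteq> 0" using assms(1,2) by linarith
  \<comment> \<open>\<open>A2\<close> is singular, but its cube is
    \<open>(sqrt (g * H))\<^sup>2\<close> times itself, so this multiple of \<open>A2\<close>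
    recovers the flux density from the conormal trace.\<close>
  then have M2: "(A2 g H *v u) \<bullet> (((1 / (sqrt (g * H))\<^sup>2) *\<^sub>R A2 g H) *v (A2 g H *v u)) = u \<bullet> (A2 g H *v u)" for u
    unfolding scaleR_matrix_vector_assoc[symmetric]
    by (simp add: A2_mult inner_3 power2_eq_square del: real_sqrt_mult_self real_sqrt_eq_zero_cancel_iff)
  have wc: "(\<lambda>z::real \<times> real. exp (a * fst z) * x) \<in> borel_measurable borel" for x
    by (intro borel_measurable_continuous_onI continuous_intros)
  have wcK: "\<bar>exp (a * fst z) * x\<bar> \<le> K"
    if "0 < x" "x \<le> 2 * L" "z \<in> {0<..<T} \<times> {0<..<1}" for x and z :: "real \<times> real"
    using that ex[of "fst z" x] by (auto simp: abs_mult)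
  have lim1: "Lp_tendsto 2 ({0<..<T} \<times> {0<..<1}) (\<lambda>n z. A1 g H W *v \<Phi> n (fst z) L (snd z))
      (\<lambda>z. A1 g H W *v U (fst z) L (snd z))"
    and lim2: "Lp_tendsto 2 ({0<..<T} \<times> {0<..<1}) (\<lambda>n z. A1 g H W *v \<Phi> n (fst z) 0 (snd z))
      (\<lambda>z. A1 g H W *v U (fst z) 0 (snd z))"
    using tr' by blast+
  have L: "L \<le> 2 * L" "0 < 2 * L"
    using \<open>0 < L\<close> by auto
  note c1 = conormal_trace_tendsto[OF M1 lim1 wc wcK[OF \<open>0 < L\<close> L(1)] contx S, simplified]
  note c2 = conormal_trace_tendsto[OF M1 lim2 wc wcK[OF L(2) order_refl] contx S, simplified]
  have intA2: "set_integrable lborel ({0<..<T} \<times> X) (\<lambda>z. \<Phi> n (fst z) (snd z) y \<bullet> (A2 g H *v \<Phi> n (fst z) (snd z) y))"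
    if "bounded X" "X \<in> sets borel" for X :: "real set" and n y
    by (intro set_integrable_continuous_bounded continuous_on_inner conty S that
        bounded_linear.continuous_on[OF matrix_vector_mul_bounded_linear])
  have lim3: "Lp_tendsto 1 ({0<..<T} \<times> {0<..<L})
      (\<lambda>n z. \<Phi> n (fst z) (snd z) 1 \<bullet> (A2 g H *v \<Phi> n (fst z) (snd z) 1))
      (\<lambda>z. U (fst z) (snd z) 1 \<bullet> (A2 g H *v U (fst z) (snd z) 1))"
    and lim4: "Lp_tendsto 1 ({0<..<T} \<times> wall0 L)
      (\<lambda>n z. \<Phi> n (fst z) (snd z) 0 \<bullet> (A2 g H *v \<Phi> n (fst z) (snd z) 0))
      (\<lambda>z. U (fst z) (snd z) 0 \<bullet> (A2 g H *v U (fst z) (snd z) 0))"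
    and lim5: "Lp_tendsto 2 ({0<..<T} \<times> spillway L) (\<lambda>n z. A2 g H *v \<Phi> n (fst z) (snd z) 0)
      (\<lambda>z. A2 g H *v U (fst z) (snd z) 0)"
    using tr' by blast+
  note c3 = Lp_tendsto_1_lebesgue_integral[OF lim3 w wK intA2, simplified]
  note c4 = Lp_tendsto_1_lebesgue_integral[OF lim4 w wK[OF subsetD[OF bot(1)]] intA2[OF bounded_bottom(2) sets_bottom(2)], simplified]
  note c5 = conormal_trace_tendsto[OF M2 lim5 w wK[OF subsetD[OF bot(2)]] conty S[OF bounded_bottom(3) sets_bottom(3)], simplified]
  have Un: "{0<..<T} \<times> bottom L = {0<..<T} \<times> wall0 L \<union> {0<..<T} \<times> spillway L"
    "{0<..<T} \<times> wall0 L \<inter> {0<..<T} \<times> spillway L = {}"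
    by (auto simp: bottom_def wall0_def spillway_def)
  let ?b = "\<lambda>U z. w z * (U (fst z) (snd z) 0 \<bullet> (A2 g H *v U (fst z) (snd z) 0))"
  have i6: "set_integrable lborel ({0<..<T} \<times> bottom L) (?b U)"
    unfolding Un(1) by (rule set_integrable_Un[OF c4(1) c5(1)]) (auto intro: S)
  have sp: "set_integrable lborel ({0<..<T} \<times> X) (?b (\<Phi> n))" if "bounded X" "X \<in> sets borel" for X n
    unfolding w_def
    by (intro set_integrable_continuous_bounded continuous_intros continuous_on_inner conty S that
        bounded_linear.continuous_on[OF matrix_vector_mul_bounded_linear])
  have c6: "(\<lambda>n. LINT z:{0<..<T} \<times> bottom L|lborel. ?b (\<Phi> n) z) \<longlonglongrightarrow> (LINT z:{0<..<T} \<times> bottom L|lborel. ?b U z)"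
    unfolding Un(1) set_integral_Un[OF Un(2) c4(1) c5(1)]
      set_integral_Un[OF Un(2) sp[OF bounded_bottom(2) sets_bottom(2)] sp[OF bounded_bottom(3) sets_bottom(3)]]
    by (intro tendsto_add c4(2) c5(2))
  show "traces_integrable g H W L a T U"
    using c1(1) c2(1) c3(1) i6 unfolding traces_integrable_def w_def by blast
  show "(\<lambda>n. boundary_flux g H W L a T (\<Phi> n)) \<longlonglongrightarrow> boundary_flux g H W L a T U"
    unfolding boundary_flux_def
    by (intro tendsto_add tendsto_diff c1(2) c2(2) c3(2)[unfolded w_def] c6[unfolded w_def])
qed

section \<open>The boundary flux as a time integral of the boundary term\<close>

lemma BC_eq:
  assumes "0 < L"
  shows "BC g H W L U t =
      L * (LINT y:{0<..<1}|lborel. U t L y \<bullet> (A1 g H W *v U t L y))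
    - 2 * L * (LINT y:{0<..<1}|lborel. U t 0 y \<bullet> (A1 g H W *v U t 0 y))
    + (LINT x:{0<..<L}|lborel. (2 * L - x) * (U t x 1 \<bullet> (A2 g H *v U t x 1)))
    - (LINT x:bottom L|lborel. (2 * L - x) * (U t x 0 \<bullet> (A2 g H *v U t x 0)))"
proof -
  \<comment> \<open>\<open>U\<close> is arbitrary here, so the sign is pulled out of possibly
    undefined integrals; the default value 0 respects it.\<close>
  have neg: "(LINT x:X|lborel. - f x) = - (LINT x:X|lborel. f x)" for X and f :: "real \<Rightarrow> real"
    by (simp add: set_lebesgue_integral_def)
  show ?thesis
    unfolding BC_def boundary_integral_def set_integral_bottom[OF assms]
    by (simp add: matrix_vector_mult_add_rdistrib scaleR_matrix_vector_assoc[symmetric] neg)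
qed

text \<open>The left form passes to the limit, the right one has a known sign: \<open>BC\<close> is
  nonnegative for almost every single time. Fubini on each side connects them.\<close>

lemma boundary_flux_eq:
  assumes "0 < L" "traces_integrable g H W L a T U"
  shows "set_integrable lborel {0<..<T} (\<lambda>t. exp (a * t) * BC g H W L U t)"
    and "boundary_flux g H W L a T U = (LINT t:{0<..<T}|lborel. exp (a * t) * BC g H W L U t)"
proof -
  note i = assms(2)[unfolded traces_integrable_def]
  note int = set_integral_Times_integrable[OF i[THEN conjunct1]]
    set_integral_Times_integrable[OF i[THEN conjunct2, THEN conjunct1]]
    set_integral_Times_integrable[OF i[THEN conjunct2, THEN conjunct2, THEN conjunct1]]
    set_integral_Times_integrable[OF i[THEN conjunct2, THEN conjunct2, THEN conjunct2]]
  note eq = set_integral_Times_fst[OF i[THEN conjunct1]]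
    set_integral_Times_fst[OF i[THEN conjunct2, THEN conjunct1]]
    set_integral_Times_fst[OF i[THEN conjunct2, THEN conjunct2, THEN conjunct1]]
    set_integral_Times_fst[OF i[THEN conjunct2, THEN conjunct2, THEN conjunct2]]
  note sum = set_integral_diff[OF set_integral_add(1)[OF set_integral_diff(1)[OF int(1,2)] int(3)] int(4)]
    set_integral_add(2)[OF set_integral_diff(1)[OF int(1,2)] int(3)]
    set_integral_diff(2)[OF int(1,2)]
  have "exp (a * t) * BC g H W L U t =
      (LINT y:{0<..<1}|lborel. (exp (a * t) * L) * (U t L y \<bullet> (A1 g H W *v U t L y)))
    - (LINT y:{0<..<1}|lborel. (exp (a * t) * (2 * L)) * (U t 0 y \<bullet> (A1 g H W *v U t 0 y)))
    + (LINT x:{0<..<L}|lborel. (exp (a * t) * (2 * L - x)) * (U t x 1 \<bullet> (A2 g H *v U t x 1)))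
    - (LINT x:bottom L|lborel. (exp (a * t) * (2 * L - x)) * (U t x 0 \<bullet> (A2 g H *v U t x 0)))" for t
    unfolding BC_eq[OF assms(1)] mult.assoc set_integral_mult_right
    by (simp add: right_diff_distrib distrib_left)
  note key = this
  show "set_integrable lborel {0<..<T} (\<lambda>t. exp (a * t) * BC g H W L U t)"
    using sum(1) by (simp only: key fst_conv snd_conv)
  show "boundary_flux g H W L a T U = (LINT t:{0<..<T}|lborel. exp (a * t) * BC g H W L U t)"
    unfolding boundary_flux_def eq[symmetric] sum(2-4)[symmetric]
    by (simp only: key fst_conv snd_conv)
qed


section \<open>The sign of the boundary term\<close>

text \<open>The exceptional set is enclosed in a Borel null set, to which the affine change of
  variable applies, whether or not \<open>P\<close> is measurable. This carries the spillway law
  over to the gate parameter \<open>y\<close>.\<close>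

lemma AE_lborel_affine:
  fixes P :: "real \<Rightarrow> bool"
  assumes "c \<noteq> 0" "AE x in lborel. P x"
  shows "AE x in lborel. P (t + c * x)"
proof -
  obtain N where N: "N \<in> null_sets lborel" "{x. \<not> P x} \<subseteq> N"
    using assms(2) unfolding eventually_ae_filter by auto
  then have [measurable]: "N \<in> sets borel" by auto
  have "AE x in lborel. x \<notin> N"
    using N(1) by (rule AE_not_in)
  then have "AE x in lborel. t + c * x \<notin> N"
    by (intro AE_borel_affine[where P = "\<lambda>x. x \<notin> N"] assms(1)) measurable
  then show ?thesis
    by eventually_elim (use N(2) in auto)
qed

lemma AE_lborel_slice:
  fixes P :: "real \<Rightarrow> real \<Rightarrow> bool"
  assumes "AE (x, y) in lborel. P x y"
  shows "AE x in lborel. AE y in lborel. P x y"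
proof -
  have "AE z in lborel \<Otimes>\<^sub>M lborel. case z of (x, y) \<Rightarrow> P x y"
    using assms unfolding lborel_prod .
  from lborel_pair.AE_pair[OF this] show ?thesis
    by simp
qed

lemma set_integral_nonneg_AE:
  fixes f :: "'a \<Rightarrow> real"
  assumes "AE x in M. x \<in> S \<longrightarrow> 0 \<le> f x"
  shows "0 \<le> (LINT x:S|M. f x)"
  unfolding set_lebesgue_integral_def
  by (rule integral_nonneg_AE) (use assms in \<open>auto simp: indicator_def\<close>)

section \<open>Pointwise signs on the gates and the spillway\<close>

text \<open>Subtracting the two root equations gives Vieta's
  \<open>\<alpha> * (r1 + r2) = -1\<close>, hence the factorization
  \<open>\<alpha> * ((s - r1) * (s - r2))\<close>.\<close>

lemma quadratic_neg_between_roots: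
  fixes \<alpha> r1 r2 s :: real
  assumes "0 < \<alpha>" "r1 < r2" "\<alpha> * r1\<^sup>2 + r1 + \<alpha> = 0" "\<alpha> * r2\<^sup>2 + r2 + \<alpha> = 0" "s \<in> {r1<..<r2}"
  shows "\<alpha> * s\<^sup>2 + s + \<alpha> < 0"
proof -
  have "(r2 - r1) * (\<alpha> * (r1 + r2) + 1) = (\<alpha> * r2\<^sup>2 + r2 + \<alpha>) - (\<alpha> * r1\<^sup>2 + r1 + \<alpha>)"
    by (simp add: power2_eq_square algebra_simps)
  then have "(r2 - r1) * (\<alpha> * (r1 + r2) + 1) = 0"
    using assms by simp
  then have sum: "\<alpha> * (r1 + r2) = - 1"
    using assms(2) by simp
  have "\<alpha> * s\<^sup>2 + s + \<alpha> = \<alpha> * s\<^sup>2 - (\<alpha> * (r1 + r2)) * s - (\<alpha> * r1\<^sup>2 - (\<alpha> * (r1 + r2)) * r1)"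
    unfolding sum using assms(3) by simp
  also have "\<dots> = \<alpha> * ((s - r1) * (s - r2))"
    by (simp add: power2_eq_square algebra_simps)
  also have "\<dots> < 0"
    using assms by (auto simp: mult_less_0_iff zero_less_mult_iff)
  finally show ?thesis .
qed

text \<open>In the characteristic variables \<open>p = h + w\<close> and
  \<open>h - w = k1 * p\<close>, the first two components contribute half of
  \<open>(W + c) * p\<^sup>2 + (W - c) * (k1 * p)\<^sup>2\<close>. The outgoing wave dominates the
  reflected one when the reflection coefficient is below 1 in modulus.\<close>

lemma gate_flux_right:
  fixes g H W k1 :: real and u :: "real^3"
  assumes "0 < W" "W < sqrt (g * H)" "\<bar>k1\<bar> < 1" "u $ 1 - u $ 2 = k1 * (u $ 1 + u $ 2)"
  shows "0 \<le> u \<bullet> (A1 g H W *v u)"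
proof -
  define c p where "c = sqrt (g * H)" and "p = u $ 1 + u $ 2"
  have h: "u $ 1 = (p + k1 * p) / 2" "u $ 2 = (p - k1 * p) / 2"
    using assms(4) by (simp_all add: p_def)
  have "u \<bullet> (A1 g H W *v u) = ((1 + k1\<^sup>2) * W + c * (1 - k1\<^sup>2)) / 2 * p\<^sup>2 + W * (u $ 3)\<^sup>2"
    unfolding A1_quadratic h c_def[symmetric] by (simp add: field_simps power2_eq_square)
  moreover have "k1\<^sup>2 \<le> 1"
    using assms(3) by (simp add: abs_square_le_1)
  moreover have "0 < c"
    using assms unfolding c_def by linarith
  ultimately show ?thesis
    using assms(1) by simp
qed

text \<open>The gate law reads \<open>w = s * h\<close> with \<open>s = (k2 - 1) / (k2 + 1)\<close>,
  so the part of the flux in \<open>h\<close> and \<open>w\<close> is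
  \<open>2 * c * h\<^sup>2\<close> times the quadratic of the hypothesis at
  \<open>s\<close>.\<close>

lemma gate_flux_left:
  fixes g H W k2 :: real and u :: "real^3"
  assumes "0 < W" "W < sqrt (g * H)" "k2 \<noteq> -1" "u $ 1 + u $ 2 = k2 * (u $ 1 - u $ 2)"
    and "W / (2 * sqrt (g * H)) * ((k2 - 1) / (k2 + 1))\<^sup>2 + (k2 - 1) / (k2 + 1) + W / (2 * sqrt (g * H)) < 0"
  shows "u \<bullet> (A1 g H W *v u) \<le> W * (u $ 3)\<^sup>2"
proof -
  define c s where "c = sqrt (g * H)" and "s = (k2 - 1) / (k2 + 1)"
  have "c > 0" using assms unfolding c_def by linarith
  have "k2 + 1 \<noteq> 0" using assms(3) by linarith
  have "(k2 + 1) * u $ 2 = (k2 - 1) * u $ 1"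
    using assms(4) by (simp add: algebra_simps)
  then have w: "u $ 2 = s * u $ 1"
    using \<open>k2 + 1 \<noteq> 0\<close> by (simp add: s_def field_simps)
  have "u \<bullet> (A1 g H W *v u) = 2 * c * (W / (2 * c) * s\<^sup>2 + s + W / (2 * c)) * (u $ 1)\<^sup>2 + W * (u $ 3)\<^sup>2"
    unfolding A1_quadratic w c_def[symmetric] using \<open>c > 0\<close> by (simp add: field_simps power2_eq_square)
  moreover have "2 * c * (W / (2 * c) * s\<^sup>2 + s + W / (2 * c)) * (u $ 1)\<^sup>2 \<le> 0"
    using assms(5) \<open>c > 0\<close> unfolding c_def[symmetric] s_def[symmetric]
    by (intro mult_nonpos_nonneg mult_nonneg_nonpos) auto
  ultimately show ?thesis by linarith
qed

text \<open>\<open>2 * c * h * v\<close> is \<open>c / 2\<close> times the difference of the squares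
  of \<open>h + v\<close> and \<open>h - v\<close>. The minus sign is that of the outward normal (0,
  -1), so the right side is energy leaving through the spillway.\<close>

lemma spillway_flux:
  fixes g H k3 :: real and u :: "real^3"
  assumes "u $ 1 + u $ 3 = k3 * (u $ 1 - u $ 3)"
  shows "- (u \<bullet> (A2 g H *v u)) = sqrt (g * H) / 2 * (1 - k3\<^sup>2) * (u $ 1 - u $ 3)\<^sup>2"
proof -
  define q where "q = u $ 1 - u $ 3"
  have h: "u $ 1 = (k3 * q + q) / 2" "u $ 3 = (k3 * q - q) / 2"
    using assms by (simp_all add: q_def)
  show ?thesis
    unfolding A2_quadratic q_def[symmetric] unfolding h by (simp add: field_simps power2_eq_square)
qed

section \<open>The sign of the boundary term at a fixed time\<close>

lemma BC_nonneg:
  fixes g H W L k1 k2 k3 k4 :: real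
  assumes W: "0 < W" "W < sqrt (g * H)" and L: "0 < L"
    and k1: "\<bar>k1\<bar> < 1" and k3: "\<bar>k3\<bar> < 1" and k2: "k2 \<noteq> -1"
      "W / (2 * sqrt (g * H)) * ((k2 - 1) / (k2 + 1))\<^sup>2 + (k2 - 1) / (k2 + 1) + W / (2 * sqrt (g * H)) < 0"
    and k4: "12 * W * k4\<^sup>2 \<le> L * sqrt (g * H) * (1 - k3\<^sup>2)"
    and top: "AE x in lborel. x \<in> {0<..<L} \<longrightarrow> U t x 1 $ 3 = 0"
    and wall: "AE x in lborel. x \<in> wall0 L \<longrightarrow> U t x 0 $ 3 = 0"
    and right: "AE y in lborel. y \<in> {0<..<1} \<longrightarrow> U t L y $ 1 - U t L y $ 2 = k1 * (U t L y $ 1 + U t L y $ 2)"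
    and left: "AE y in lborel. y \<in> {0<..<1} \<longrightarrow> U t 0 y $ 1 + U t 0 y $ 2 = k2 * (U t 0 y $ 1 - U t 0 y $ 2)"
    and spill: "AE x in lborel. x \<in> spillway L \<longrightarrow> U t x 0 $ 1 + U t x 0 $ 3 = k3 * (U t x 0 $ 1 - U t x 0 $ 3)"
    and feedback: "AE y in lborel. y \<in> {0<..<1} \<longrightarrow>
      U t 0 y $ 3 = k4 * (U t (L/3 * (y + 1)) 0 $ 1 - U t (L/3 * (y + 1)) 0 $ 3)"
    and int0: "set_integrable lborel {0<..<1} (\<lambda>y. U t 0 y \<bullet> (A1 g H W *v U t 0 y))"
    and intb: "set_integrable lborel (bottom L) (\<lambda>x. (2 * L - x) * (U t x 0 \<bullet> (A2 g H *v U t x 0)))"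
  shows "0 \<le> BC g H W L U t"
proof -
  define c where "c = sqrt (g * H)"
  have "c > 0" using W unfolding c_def by linarith
  have k3': "0 < 1 - k3\<^sup>2"
    using k3 by (simp add: abs_square_less_1)
  \<comment> \<open>Bounding the trace of \<open>v\<close> at \<open>x = 0\<close> by the flux density \<open>m\<close> itself, not by \<open>(h - v)\<^sup>2\<close>,
    makes \<open>intb\<close> the only integrability needed on the spillway.\<close>
  define m where "m x = (2 * L - x) * - (U t x 0 \<bullet> (A2 g H *v U t x 0))" for x
  \<comment> \<open>Chosen so that \<open>W * k4\<^sup>2\<close> equals
    \<open>\<beta> * (L * (c / 2 * (1 - k3\<^sup>2)))\<close>; the smallness hypothesis on
    \<open>k4\<close> is then exactly \<open>6 * \<beta> \<le> 1\<close>.\<close>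
  define \<beta> where "\<beta> = 2 * W * k4\<^sup>2 / (L * c * (1 - k3\<^sup>2))"
  define J where "J = (LINT x:spillway L|lborel. m x)"
  have "6 * \<beta> \<le> 1" "0 \<le> \<beta>"
    using k4 W L \<open>c > 0\<close> k3' by (simp_all add: \<beta>_def c_def field_simps)
  \<comment> \<open>On the spillway \<open>x < 2 * L / 3\<close>, so the weight is at least
    \<open>L\<close>.\<close>
  have m_spill: "L * (c / 2 * (1 - k3\<^sup>2) * (U t x 0 $ 1 - U t x 0 $ 3)\<^sup>2) \<le> m x"
    if "x \<in> spillway L" "U t x 0 $ 1 + U t x 0 $ 3 = k3 * (U t x 0 $ 1 - U t x 0 $ 3)" for x
    unfolding m_def spillway_flux[OF that(2)] c_def[symmetric]
    using that(1) L \<open>c > 0\<close> k3' by (intro mult_right_mono) (auto simp: spillway_def)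
  have "AE x in lborel. x \<in> bottom L \<longrightarrow> 0 \<le> m x"
    using wall spill
  proof eventually_elim
    case (elim x)
    show ?case
    proof (cases "x \<in> spillway L")
      case True
      then have "0 \<le> L * (c / 2 * (1 - k3\<^sup>2) * (U t x 0 $ 1 - U t x 0 $ 3)\<^sup>2)"
        using L \<open>c > 0\<close> k3' by simp
      also have "\<dots> \<le> m x"
        using True elim by (intro m_spill) auto
      finally show ?thesis by simp
    next
      case False
      then show ?thesis
        using elim by (auto simp: bottom_def m_def A2_quadratic)
    qed
  qed
  note m_nonneg = this
  have int_m: "set_integrable lborel (bottom L) m"
    using set_integrable_mult_right[of "-1", OF intb] by (simp add: m_def[abs_def])
  have int_ms: "set_integrable lborel (spillway L) m"
    by (rule set_integrable_subset[OF int_m]) (auto simp: bottom_def)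
  have "J \<le> (LINT x:bottom L|lborel. m x)"
    unfolding J_def set_lebesgue_integral_def
  proof (rule integral_mono_AE)
    show "AE x in lborel. indicator (spillway L) x *\<^sub>R m x \<le> indicator (bottom L) x *\<^sub>R m x"
      using m_nonneg by eventually_elim (auto simp: indicator_def bottom_def)
  qed (use int_m int_ms in \<open>auto simp: set_integrable_def\<close>)
  moreover have "0 \<le> J"
    unfolding J_def
    by (rule set_integral_nonneg_AE) (use m_nonneg in \<open>auto simp: bottom_def\<close>)
  moreover have "(LINT x:bottom L|lborel. m x) = - (LINT x:bottom L|lborel. (2 * L - x) * (U t x 0 \<bullet> (A2 g H *v U t x 0)))"
    using set_integral_uminus[OF intb] by (simp add: m_def)
  moreover have "(LINT y:{0<..<1}|lborel. U t 0 y \<bullet> (A1 g H W *v U t 0 y)) \<le> \<beta> * (3 / L * J)"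
  proof -
    \<comment> \<open>The sensor position, written as an affine map of (0, 1) onto the spillway; its
      Jacobian \<open>L / 3\<close> yields the factor \<open>3 / L\<close>.\<close>
    let ?s = "\<lambda>y. L / 3 + L / 3 * y"
    have s: "L / 3 * (y + 1) = ?s y" for y
      by (simp add: algebra_simps)
    have L3: "L / 3 \<noteq> 0" using L by simp
    have ind: "indicator (spillway L) (?s y) = (indicator {0<..<1} y :: real)" for y
      using L by (auto simp: indicator_def spillway_def field_simps zero_less_mult_iff)
    have "integrable lborel (\<lambda>y. indicator (spillway L) (?s y) *\<^sub>R m (?s y))"
      using lborel_integrable_real_affine[OF int_ms[unfolded set_integrable_def] L3, of "L / 3"] .
    then have int_s: "set_integrable lborel {0<..<1} (\<lambda>y. m (?s y))"
      unfolding ind set_integrable_def .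
    have J_eq: "J = L / 3 * (LINT y:{0<..<1}|lborel. m (?s y))"
      using lborel_integral_real_affine[OF L3, of "\<lambda>x. indicator (spillway L) x *\<^sub>R m x" "L / 3"] L
      unfolding J_def set_lebesgue_integral_def ind by simp
    have J: "(LINT y:{0<..<1}|lborel. m (?s y)) = 3 / L * J"
      unfolding J_eq using L by simp
    have "(LINT y:{0<..<1}|lborel. U t 0 y \<bullet> (A1 g H W *v U t 0 y)) \<le> (LINT y:{0<..<1}|lborel. \<beta> * m (?s y))"
      unfolding set_lebesgue_integral_def
    proof (rule integral_mono_AE)
      show "AE y in lborel. indicator {0<..<1} y *\<^sub>R (U t 0 y \<bullet> (A1 g H W *v U t 0 y))
          \<le> indicator {0<..<1} y *\<^sub>R (\<beta> * m (?s y))"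
        using left feedback AE_lborel_affine[OF L3 spill, of "L / 3"]
      proof eventually_elim
        case (elim y)
        show ?case
        proof (cases "y \<in> {0<..<1}")
          case True
          define Q where "Q = (U t (?s y) 0 $ 1 - U t (?s y) 0 $ 3)\<^sup>2"
          have sp: "?s y \<in> spillway L"
            using True L by (auto simp: spillway_def field_simps)
          have "U t 0 y \<bullet> (A1 g H W *v U t 0 y) \<le> W * (U t 0 y $ 3)\<^sup>2"
            using elim True by (intro gate_flux_left[OF W k2(1) _ k2(2)]) auto
          also have "\<dots> = W * k4\<^sup>2 * Q"
            using elim True unfolding s by (simp add: Q_def power_mult_distrib)
          also have "\<dots> = \<beta> * (L * (c / 2 * (1 - k3\<^sup>2) * Q))"
            using L \<open>c > 0\<close> k3' by (simp add: \<beta>_def)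
          also have "\<dots> \<le> \<beta> * m (?s y)"
            unfolding Q_def using elim sp \<open>0 \<le> \<beta>\<close> by (intro mult_left_mono m_spill) auto
          finally show ?thesis using True by simp
        qed simp
      qed
    qed (use int0 int_s in \<open>auto simp: set_integrable_def mult.left_commute\<close>)
    also have "\<dots> = \<beta> * (3 / L * J)"
      by (simp only: set_integral_mult_right J)
    finally show ?thesis .
  qed
  \<comment> \<open>The weight at \<open>x = 0\<close> is \<open>2 * L\<close>, which with
    \<open>3 / L\<close> leaves \<open>6 * \<beta> * J\<close>, at most the spillway
    outflow.\<close>
  then have "2 * L * (LINT y:{0<..<1}|lborel. U t 0 y \<bullet> (A1 g H W *v U t 0 y)) \<le> 2 * L * (\<beta> * (3 / L * J))"
    using L by (intro mult_left_mono) auto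
  then have "2 * L * (LINT y:{0<..<1}|lborel. U t 0 y \<bullet> (A1 g H W *v U t 0 y)) \<le> 6 * \<beta> * J"
    using L by simp
  moreover have "6 * \<beta> * J \<le> 1 * J"
    using \<open>6 * \<beta> \<le> 1\<close> \<open>0 \<le> J\<close> by (rule mult_right_mono)
  moreover have "0 \<le> L * (LINT y:{0<..<1}|lborel. U t L y \<bullet> (A1 g H W *v U t L y))"
  proof -
    have "AE y in lborel. y \<in> {0<..<1} \<longrightarrow> 0 \<le> U t L y \<bullet> (A1 g H W *v U t L y)"
      using right by eventually_elim (use gate_flux_right[OF W k1] in auto)
    then show ?thesis
      using L by (intro mult_nonneg_nonneg set_integral_nonneg_AE) auto
  qed
  moreover have "(LINT x:{0<..<L}|lborel. (2 * L - x) * (U t x 1 \<bullet> (A2 g H *v U t x 1))) = 0"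
    unfolding set_lebesgue_integral_def
    by (rule integral_eq_zero_AE) (use top in \<open>eventually_elim, auto simp: A2_quadratic indicator_def\<close>)
  ultimately show ?thesis
    unfolding BC_eq[OF L] by linarith
qed


section \<open>Strong solutions\<close>

lemma strong_solution_traces_integrable:
  assumes "0 < W" "W < sqrt (g * H)" "0 < L" "0 \<le> a" "strong_solution g k l H W L U" "0 < T"
  shows "traces_integrable g H W L a T U"
proof -
  obtain \<Phi> \<Phi>t \<Phi>x \<Phi>y where "\<forall>n. C1_with_partials (\<Phi> n) (\<Phi>t n) (\<Phi>x n) (\<Phi>y n)" "traces_tendsto g H W L T \<Phi> U"
    using assms(5,6) unfolding strong_solution_def by blast
  then show ?thesis
    by (intro traces_tendsto_integrable[where \<Phi> = \<Phi>] assms C1_with_partials_continuous) blast+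
qed

text \<open>Slicing the almost-everywhere boundary laws and the integrable traces gives the
  hypotheses of \<open>BC_nonneg\<close> for almost every time. Integrability of the traces is
  available on bounded time intervals, so the half-line is exhausted by countably many of
  them.\<close>

lemma ibvp_solution_BC_nonneg:
  fixes g k l H W L k1 k2 k3 k4 :: real
  assumes W: "0 < W" "W < sqrt (g * H)" and L: "0 < L"
    and k: "\<bar>k1\<bar> < 1" "\<bar>k3\<bar> < 1" "k2 \<noteq> -1"
      "W / (2 * sqrt (g * H)) * ((k2 - 1) / (k2 + 1))\<^sup>2 + (k2 - 1) / (k2 + 1) + W / (2 * sqrt (g * H)) < 0"
      "12 * W * k4\<^sup>2 \<le> L * sqrt (g * H) * (1 - k3\<^sup>2)"
    and sol: "ibvp_solution g k l H W L k1 k2 k3 k4 U0 U"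
  shows "AE t in lborel. 0 < t \<longrightarrow> 0 \<le> BC g H W L U t"
proof -
  have U: "strong_solution g k l H W L U" "boundary_conditions L k1 k2 k3 k4 U"
    using sol by (auto simp: ibvp_solution_def)
  note bc = U(2)[unfolded boundary_conditions_def]
  note slices = bc[THEN conjunct1, THEN AE_lborel_slice]
    bc[THEN conjunct2, THEN conjunct1, THEN AE_lborel_slice]
    bc[THEN conjunct2, THEN conjunct2, THEN conjunct1, THEN AE_lborel_slice]
    bc[THEN conjunct2, THEN conjunct2, THEN conjunct2, THEN conjunct1, THEN AE_lborel_slice]
    bc[THEN conjunct2, THEN conjunct2, THEN conjunct2, THEN conjunct2, THEN conjunct1, THEN AE_lborel_slice]
    bc[THEN conjunct2, THEN conjunct2, THEN conjunct2, THEN conjunct2, THEN conjunct2, THEN AE_lborel_slice]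
  have "AE t in lborel. t \<in> {0<..<real (Suc n)} \<longrightarrow> 0 \<le> BC g H W L U t" for n
  proof -
    \<comment> \<open>With \<open>a = 0\<close> the exponential factor is 1 and only the spatial
      weight remains.\<close>
    have "traces_integrable g H W L 0 (real (Suc n)) U"
      by (rule strong_solution_traces_integrable[OF W L _ U(1)]) auto
    then have "AE t in lborel. t \<in> {0<..<real (Suc n)} \<longrightarrow>
        set_integrable lborel {0<..<1} (\<lambda>y. (exp (0 * t) * (2 * L)) * (U t 0 y \<bullet> (A1 g H W *v U t 0 y)))"
      "AE t in lborel. t \<in> {0<..<real (Suc n)} \<longrightarrow>
        set_integrable lborel (bottom L) (\<lambda>x. (exp (0 * t) * (2 * L - x)) * (U t x 0 \<bullet> (A2 g H *v U t x 0)))"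
      unfolding traces_integrable_def by (auto dest!: set_integral_Times_AE)
    then show ?thesis
      using slices
    proof eventually_elim
      case (elim t)
      show ?case
      proof
        assume t: "t \<in> {0<..<real (Suc n)}"
        have "set_integrable lborel {0<..<1} (\<lambda>y. U t 0 y \<bullet> (A1 g H W *v U t 0 y))"
          using elim(1) t L by (simp add: mult.assoc)
        moreover have "set_integrable lborel (bottom L) (\<lambda>x. (2 * L - x) * (U t x 0 \<bullet> (A2 g H *v U t x 0)))"
          using elim(2) t by simp
        ultimately show "0 \<le> BC g H W L U t"
          using elim(3-8) t by (intro BC_nonneg[OF W L k(1-5)]) auto
      qed
    qed
  qed
  then have "AE t in lborel. \<forall>n. t \<in> {0<..<real (Suc n)} \<longrightarrow> 0 \<le> BC g H W L U t"
    by (simp only: AE_all_countable) blast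
  then show ?thesis
  proof eventually_elim
    case (elim t)
    obtain n where "t < real n"
      using reals_Archimedean2 by blast
    then show ?case
      using elim[rule_format, of n] by auto
  qed
qed

text \<open>The energy inequality holds for the approximations with their own boundary flux, which
  may have any sign. The sign of \<open>BC\<close> is used only after the limit, when the residual
  has vanished and the flux is that of \<open>U\<close>.\<close>

lemma strong_solution_energy_decay:
  fixes g k l H W L T :: real
  assumes W: "0 < W" "W < sqrt (g * H)" and k: "0 < k" and L: "0 < L" "L \<ge> (sqrt (g * H))\<^sup>2 / (k * W)"
    and sol: "strong_solution g k l H W L U"
    and BC: "AE t in lborel. 0 < t \<longrightarrow> 0 \<le> BC g H W L U t"
    and T: "0 < T"
  shows "exp (W / (8 * L) * T) * (LINT z:Omega L|lborel. (2 * L - fst z) * (U T (fst z) (snd z) \<bullet> U T (fst z) (snd z)))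
    \<le> (LINT z:Omega L|lborel. (2 * L - fst z) * (U 0 (fst z) (snd z) \<bullet> U 0 (fst z) (snd z)))"
proof -
  define a where "a = W / (8 * L)"
  have "0 \<le> a" using W L by (simp add: a_def)
  obtain \<Phi> \<Phi>t \<Phi>x \<Phi>y where C1: "\<And>n. C1_with_partials (\<Phi> n) (\<Phi>t n) (\<Phi>x n) (\<Phi>y n)"
    and res: "Lp_tendsto 2 ({0<..<T} \<times> Omega L)
          (\<lambda>n (t, x, y). \<Phi>t n t x y + A1 g H W *v \<Phi>x n t x y + A2 g H *v \<Phi>y n t x y - B k l *v \<Phi> n t x y)
          (\<lambda>_. 0)"
    and init: "\<And>t. t \<in> {0..T} \<Longrightarrow> Lp_tendsto 2 (Omega L) (\<lambda>n (x, y). \<Phi> n t x y) (\<lambda>(x, y). U t x y)"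
    and tr: "traces_tendsto g H W L T \<Phi> U"
    using sol T unfolding strong_solution_def by blast
  note cont = C1_with_partials_continuous[OF C1]
  define E where "E U t = (LINT z:Omega L|lborel. (2 * L - fst z) * (U t (fst z) (snd z) \<bullet> U t (fst z) (snd z)))"
    for U :: "real \<Rightarrow> real \<Rightarrow> real \<Rightarrow> real^3" and t
  define R where "R n = (\<lambda>(t, x, y). \<Phi>t n t x y + A1 g H W *v \<Phi>x n t x y + A2 g H *v \<Phi>y n t x y
    - B k l *v \<Phi> n t x y)" for n
  define r where "r n = (LINT z:{0<..<T} \<times> Omega L|lborel. R n z \<bullet> R n z)" for n
  have ineq: "exp (a * T) * E (\<Phi> n) T - E (\<Phi> n) 0 + boundary_flux g H W L a T (\<Phi> n)
      \<le> exp (a * T) * (16 * L\<^sup>2 / W) * r n" for n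
    unfolding E_def r_def R_def a_def
    by (rule energy_inequality[OF W(1) k L _ C1]) (use T in simp)
  have E: "(\<lambda>n. E (\<Phi> n) t) \<longlonglongrightarrow> E U t" if "t \<in> {0..T}" for t
  proof -
    have "continuous_on UNIV (\<lambda>z::real \<times> real. (t, fst z, snd z))"
      by (intro continuous_intros)
    from continuous_on_compose2[OF cont this subset_UNIV]
    have c: "continuous_on UNIV (\<lambda>z. \<Phi> n t (fst z) (snd z))" for n
      by (simp add: case_prod_unfold)
    \<comment> \<open>With the identity as both matrices, the conormal trace lemma becomes
      convergence of weighted energies; below it is reused with weight 1 for the residual.\<close>
    have lim: "Lp_tendsto 2 (Omega L) (\<lambda>n z. mat 1 *v \<Phi> n t (fst z) (snd z)) (\<lambda>z. mat 1 *v U t (fst z) (snd z))"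
      using init[OF that] by (simp add: case_prod_unfold)
    have w: "(\<lambda>z::real \<times> real. 2 * L - fst z) \<in> borel_measurable borel"
      by (intro borel_measurable_continuous_onI continuous_intros)
    have wK: "\<bar>2 * L - fst z\<bar> \<le> 2 * L" if "z \<in> Omega L" for z :: "real \<times> real"
      using that by (auto simp: Omega_def)
    have "(mat 1 *v u) \<bullet> (mat 1 *v (mat 1 *v u)) = u \<bullet> (mat 1 *v u)" for u :: "real^3"
      by simp
    from conormal_trace_tendsto(2)[OF this lim w wK c bounded_Omega sets_Omega]
    show ?thesis
      by (simp add: E_def)
  qed
  have "r \<longlonglongrightarrow> 0"
  proof -
    have cR: "continuous_on UNIV (R n)" for n
    proof -
      have "continuous_on UNIV (\<lambda>z. case z of (t, x, y) \<Rightarrow> \<Phi>t n t x y)"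
        "continuous_on UNIV (\<lambda>z. case z of (t, x, y) \<Rightarrow> \<Phi>x n t x y)"
        "continuous_on UNIV (\<lambda>z. case z of (t, x, y) \<Rightarrow> \<Phi>y n t x y)"
        using C1[of n] by (auto simp: C1_with_partials_def)
      then show ?thesis
        using cont[of n] unfolding R_def case_prod_unfold
        by (intro continuous_intros bounded_linear.continuous_on[OF matrix_vector_mul_bounded_linear])
    qed
    have lim: "Lp_tendsto 2 ({0<..<T} \<times> Omega L) (\<lambda>n z. mat 1 *v R n z) (\<lambda>z. mat 1 *v 0)"
      using res by (simp add: R_def)
    have "(mat 1 *v u) \<bullet> (mat 1 *v (mat 1 *v u)) = u \<bullet> (mat 1 *v u)" for u :: "real^3"
      by simp
    from conormal_trace_tendsto(2)[OF this lim borel_measurable_const[of 1] _ cR, of 1]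
    show ?thesis
      by (simp add: r_def[abs_def] bounded_Times borel_Times)
  qed
  then have residual: "(\<lambda>n. exp (a * T) * (16 * L\<^sup>2 / W) * r n) \<longlonglongrightarrow> exp (a * T) * (16 * L\<^sup>2 / W) * 0"
    by (intro tendsto_intros)
  have "(\<lambda>n. exp (a * T) * E (\<Phi> n) T - E (\<Phi> n) 0 + boundary_flux g H W L a T (\<Phi> n))
      \<longlonglongrightarrow> exp (a * T) * E U T - E U 0 + boundary_flux g H W L a T U"
    using T by (intro tendsto_intros E boundary_flux_tendsto(2) W L \<open>0 \<le> a\<close> cont tr) auto
  then have "exp (a * T) * E U T - E U 0 + boundary_flux g H W L a T U \<le> exp (a * T) * (16 * L\<^sup>2 / W) * 0"
    by (rule LIMSEQ_le[OF _ residual]) (use ineq in auto)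
  moreover have "0 \<le> boundary_flux g H W L a T U"
    unfolding boundary_flux_eq(2)[OF L(1) traces_tendsto_integrable[OF W L(1) \<open>0 \<le> a\<close> cont tr]]
    by (rule set_integral_nonneg_AE) (use BC in \<open>eventually_elim, auto\<close>)
  ultimately show ?thesis
    unfolding E_def a_def by simp
qed

section \<open>Comparison of the weighted energy with the norm\<close>

lemma in_Lp_2_inner_integrable:
  fixes f :: "'a::euclidean_space \<Rightarrow> 'b::euclidean_space"
  assumes "in_Lp 2 S f"
  shows "set_integrable lborel S (\<lambda>z. f z \<bullet> f z)"
proof -
  have m: "(\<lambda>z. indicator S z *\<^sub>R f z) \<in> borel_measurable lborel"
    and fin: "(\<integral>\<^sup>+z\<in>S. ennreal (norm (f z) ^ 2) \<partial>lborel) < \<infinity>"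
    using assms by (auto simp: in_Lp_def set_borel_measurable_def)
  have eq: "(\<lambda>z. (indicator S z *\<^sub>R f z) \<bullet> (indicator S z *\<^sub>R f z)) = (\<lambda>z. indicator S z *\<^sub>R (f z \<bullet> f z))"
    by (auto simp: indicator_def)
  have "(\<integral>\<^sup>+z. ennreal (norm (indicator S z *\<^sub>R (f z \<bullet> f z))) \<partial>lborel) =
      (\<integral>\<^sup>+z\<in>S. ennreal (norm (f z) ^ 2) \<partial>lborel)"
    by (intro nn_integral_cong) (auto simp: indicator_def power2_norm_eq_inner)
  then show ?thesis
    unfolding set_integrable_def
    using fin by (intro integrableI_bounded borel_measurable_inner[OF m m, unfolded eq]) simp
qed

text \<open>The weight lies between \<open>L\<close> and \<open>2 * L\<close> on
  \<open>Omega L\<close>; the ratio 2 of these bounds is the source of the constant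
  \<open>sqrt 2\<close> in the decay estimate.\<close>

lemma energy_norm_bounds:
  assumes L: "0 < L" and u: "in_Lp 2 (Omega L) (\<lambda>(x, y). u x y)"
  shows "L * (L2_norm_on L u)\<^sup>2 \<le> (LINT z:Omega L|lborel. (2 * L - fst z) * (u (fst z) (snd z) \<bullet> u (fst z) (snd z)))"
    and "(LINT z:Omega L|lborel. (2 * L - fst z) * (u (fst z) (snd z) \<bullet> u (fst z) (snd z))) \<le> 2 * L * (L2_norm_on L u)\<^sup>2"
proof -
  let ?q = "\<lambda>z. u (fst z) (snd z) \<bullet> u (fst z) (snd z)"
  have int: "set_integrable lborel (Omega L) ?q"
    using in_Lp_2_inner_integrable[OF u] by (simp add: case_prod_unfold)
  have intw: "set_integrable lborel (Omega L) (\<lambda>z. (2 * L - fst z) * ?q z)"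
  proof (rule set_integrable_bound)
    show "set_integrable lborel (Omega L) (\<lambda>z. 2 * L * ?q z)"
      using int by simp
    have "(\<lambda>z. (2 * L - fst z) * (indicator (Omega L) z *\<^sub>R ?q z)) \<in> borel_measurable lborel"
      by (intro borel_measurable_times borel_measurable_integrable[OF int[unfolded set_integrable_def]])
        (auto intro!: borel_measurable_continuous_onI continuous_intros)
    then show "set_borel_measurable lborel (Omega L) (\<lambda>z. (2 * L - fst z) * ?q z)"
      by (simp add: set_borel_measurable_def mult.left_commute)
    show "AE z in lborel. z \<in> Omega L \<longrightarrow> norm ((2 * L - fst z) * ?q z) \<le> norm (2 * L * ?q z)"
      by (auto simp: Omega_def abs_mult intro!: mult_right_mono)
  qed
  have "0 \<le> (LINT z:Omega L|lborel. ?q z)"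
    by (rule set_integral_nonneg_AE) simp
  then have norm: "(L2_norm_on L u)\<^sup>2 = (LINT z:Omega L|lborel. ?q z)"
    by (simp add: L2_norm_on_def case_prod_unfold)
  have "(LINT z:Omega L|lborel. L * ?q z) \<le> (LINT z:Omega L|lborel. (2 * L - fst z) * ?q z)"
    using int intw by (intro set_integral_mono) (auto simp: Omega_def intro!: mult_right_mono)
  then show "L * (L2_norm_on L u)\<^sup>2 \<le> (LINT z:Omega L|lborel. (2 * L - fst z) * ?q z)"
    by (simp add: norm)
  have "(LINT z:Omega L|lborel. (2 * L - fst z) * ?q z) \<le> (LINT z:Omega L|lborel. (2 * L) * ?q z)"
    using int intw by (intro set_integral_mono) (auto simp: Omega_def intro!: mult_right_mono)
  then show "(LINT z:Omega L|lborel. (2 * L - fst z) * ?q z) \<le> 2 * L * (L2_norm_on L u)\<^sup>2"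
    unfolding norm set_integral_mult_right .
qed

lemma L2_norm_on_cong_AE:
  assumes "in_Lp 2 (Omega L) (\<lambda>(x, y). u x y)" "in_Lp 2 (Omega L) (\<lambda>(x, y). v x y)"
    and "AE (x, y) in lborel. (x, y) \<in> Omega L \<longrightarrow> u x y = v x y"
  shows "L2_norm_on L u = L2_norm_on L v"
proof -
  have m: "(\<lambda>z. indicator (Omega L) z *\<^sub>R (u (fst z) (snd z) \<bullet> u (fst z) (snd z))) \<in> borel_measurable lborel"
    if "in_Lp 2 (Omega L) (\<lambda>(x, y). u x y)" for u :: "real \<Rightarrow> real \<Rightarrow> real^3"
    using borel_measurable_integrable[OF in_Lp_2_inner_integrable[OF that, unfolded set_integrable_def]]
    by (simp add: case_prod_unfold)
  have "(LINT z:Omega L|lborel. u (fst z) (snd z) \<bullet> u (fst z) (snd z)) =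
      (LINT z:Omega L|lborel. v (fst z) (snd z) \<bullet> v (fst z) (snd z))"
    unfolding set_lebesgue_integral_def
  proof (rule integral_cong_AE)
    show "AE z in lborel. indicator (Omega L) z *\<^sub>R (u (fst z) (snd z) \<bullet> u (fst z) (snd z)) =
        indicator (Omega L) z *\<^sub>R (v (fst z) (snd z) \<bullet> v (fst z) (snd z))"
      using assms(3) by eventually_elim (auto simp: indicator_def)
  qed (use m assms in auto)
  then show ?thesis
    by (simp add: L2_norm_on_def case_prod_unfold)
qed

lemma strong_solution_in_Lp:
  assumes "strong_solution g k l H W L U" "0 \<le> t"
  shows "in_Lp 2 (Omega L) (\<lambda>(x, y). U t x y)"
proof -
  have "0 < t + 1" "t \<in> {0..t + 1}" using assms(2) by auto
  then show ?thesis
    using assms(1) unfolding strong_solution_def Lp_tendsto_def by blast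
qed

section \<open>Choice of the constants and exponential decay\<close>

theorem mainTheorem4:
  fixes g k l H W :: real
  assumes "g > 0" and "k > 0" and "l > 0" and "H > 0"
    and "0 < W" and "W < sqrt (g * H)"
  shows "\<exists>L0>0. \<forall>L\<ge>L0. \<forall>k1 k2 k3 :: real.
    k1 \<in> {-1<..<1} \<longrightarrow>
    k2 \<noteq> -1 \<longrightarrow>
    (\<exists>r1 r2. r1 < r2 \<and>
       W / (2 * sqrt (g * H)) * r1\<^sup>2 + r1 + W / (2 * sqrt (g * H)) = 0 \<and>
       W / (2 * sqrt (g * H)) * r2\<^sup>2 + r2 + W / (2 * sqrt (g * H)) = 0 \<and>
       (k2 - 1) / (k2 + 1) \<in> {r1<..<r2}) \<longrightarrow>
    k3 \<in> {-1<..<1} \<longrightarrow>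
    (\<exists>\<kappa>>0. \<forall>k4 :: real. \<bar>k4\<bar> \<le> \<kappa> \<longrightarrow>
       (\<forall>U0 U. in_Lp 2 (Omega L) (\<lambda>(x, y). U0 x y) \<longrightarrow>
          ibvp_solution g k l H W L k1 k2 k3 k4 U0 U \<longrightarrow>
          (AE t in lborel. 0 < t \<longrightarrow> BC g H W L U t \<ge> 0)) \<and>
       (\<exists>\<nu>>0. \<exists>C>0. \<forall>U0 U. in_Lp 2 (Omega L) (\<lambda>(x, y). U0 x y) \<longrightarrow>
          ibvp_solution g k l H W L k1 k2 k3 k4 U0 U \<longrightarrow>
          (\<forall>t\<ge>0. L2_norm_on L (U t) \<le> C * exp (- \<nu> * t) * L2_norm_on L U0)))"
proof -
  define c where "c = sqrt (g * H)"
  \<comment> \<open>The threshold in \<open>energy_density_bound\<close> beyond which the drag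
    absorbs the cross term.\<close>
  define L0 where "L0 = c\<^sup>2 / (k * W)"
  have "0 < c" using assms(5,6) unfolding c_def by linarith
  then have "0 < L0"
    using assms by (simp add: L0_def)
  show ?thesis
  proof (rule exI[of _ L0], intro conjI allI impI)
    fix L k1 k2 k3 :: real
    assume "L0 \<le> L" and k1: "k1 \<in> {-1<..<1}" and k2: "k2 \<noteq> -1" and k3: "k3 \<in> {-1<..<1}"
      and "\<exists>r1 r2. r1 < r2 \<and>
       W / (2 * sqrt (g * H)) * r1\<^sup>2 + r1 + W / (2 * sqrt (g * H)) = 0 \<and>
       W / (2 * sqrt (g * H)) * r2\<^sup>2 + r2 + W / (2 * sqrt (g * H)) = 0 \<and>
       (k2 - 1) / (k2 + 1) \<in> {r1<..<r2}"
    then have quad: "W / (2 * sqrt (g * H)) * ((k2 - 1) / (k2 + 1))\<^sup>2 + (k2 - 1) / (k2 + 1) + W / (2 * sqrt (g * H)) < 0"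
      using quadratic_neg_between_roots[of "W / (2 * sqrt (g * H))"] assms by auto
    have L: "0 < L" "L \<ge> (sqrt (g * H))\<^sup>2 / (k * W)"
      using \<open>0 < L0\<close> \<open>L0 \<le> L\<close> by (auto simp: L0_def c_def)
    have k13: "\<bar>k1\<bar> < 1" "\<bar>k3\<bar> < 1"
      using k1 k3 by auto
    then have k3': "0 < 1 - k3\<^sup>2"
      by (simp add: abs_square_less_1)
    \<comment> \<open>The equality case of the condition on \<open>k4\<close> in
      \<open>BC_nonneg\<close>.\<close>
    define \<kappa> where "\<kappa> = sqrt (L * c * (1 - k3\<^sup>2) / (12 * W))"
    have \<kappa>: "0 < \<kappa>" "12 * W * \<kappa>\<^sup>2 = L * c * (1 - k3\<^sup>2)"
      using L \<open>0 < c\<close> k3' \<open>0 < W\<close> by (simp_all add: \<kappa>_def)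
    have nonneg: "AE t in lborel. 0 < t \<longrightarrow> BC g H W L U t \<ge> 0"
      if "\<bar>k4\<bar> \<le> \<kappa>" "ibvp_solution g k l H W L k1 k2 k3 k4 U0 U" for k4 U0 U
    proof -
      have "k4\<^sup>2 \<le> \<kappa>\<^sup>2"
        using that(1) \<kappa>(1) by (metis abs_le_square_iff abs_of_pos)
      then have "12 * W * k4\<^sup>2 \<le> L * sqrt (g * H) * (1 - k3\<^sup>2)"
        using \<kappa>(2) \<open>0 < W\<close> unfolding c_def by (metis mult_left_mono mult_pos_pos zero_less_numeral less_imp_le)
      then show ?thesis
        by (rule ibvp_solution_BC_nonneg[OF assms(5,6) L(1) k13 k2 quad _ that(2)])
    qed
    \<comment> \<open>The energy is quadratic and decays at rate \<open>W / (8 * L)\<close>, so the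
      norm decays at half of it.\<close>
    have decay: "L2_norm_on L (U t) \<le> sqrt 2 * exp (- (W / (16 * L)) * t) * L2_norm_on L U0"
      if U0: "in_Lp 2 (Omega L) (\<lambda>(x, y). U0 x y)" and "\<bar>k4\<bar> \<le> \<kappa>"
        and sol: "ibvp_solution g k l H W L k1 k2 k3 k4 U0 U" and "0 \<le> t" for k4 U0 U t
    proof -
      have U: "strong_solution g k l H W L U"
        and "AE (x, y) in lborel. (x, y) \<in> Omega L \<longrightarrow> U 0 x y = U0 x y"
        using sol by (auto simp: ibvp_solution_def)
      note in_Lp = strong_solution_in_Lp[OF U]
      have init: "L2_norm_on L (U 0) = L2_norm_on L U0"
        by (rule L2_norm_on_cong_AE) (fact | rule in_Lp order_refl)+
      have pos: "0 \<le> L2_norm_on L U0"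
        unfolding L2_norm_on_def
        by (intro real_sqrt_ge_zero set_integral_nonneg_AE) auto
      show ?thesis
      \<comment> \<open>Strong solutions are approximated on intervals of positive length, so the
        energy decay covers \<open>t > 0\<close>; at \<open>t = 0\<close> the factor
        \<open>sqrt 2\<close> suffices.\<close>
      proof (cases "t = 0")
        case True
        have "1 * L2_norm_on L U0 \<le> sqrt 2 * L2_norm_on L U0"
          using pos by (intro mult_right_mono) auto
        then show ?thesis
          by (simp add: True init)
      next
        case False
        then have "0 < t" using \<open>0 \<le> t\<close> by simp
        note strong_solution_energy_decay[OF assms(5,6,2) L U nonneg[OF that(2) sol] this]
        also note energy_norm_bounds(2)[OF L(1) in_Lp[OF order_refl]]
        finally have "exp (W / (8 * L) * t) * (L * (L2_norm_on L (U t))\<^sup>2) \<le> 2 * L * (L2_norm_on L U0)\<^sup>2"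
          using energy_norm_bounds(1)[OF L(1) in_Lp[OF \<open>0 \<le> t\<close>]] unfolding init
          by (meson exp_ge_zero mult_left_mono order_trans)
        then have "L * (exp (W / (8 * L) * t) * (L2_norm_on L (U t))\<^sup>2) \<le> L * (2 * (L2_norm_on L U0)\<^sup>2)"
          by (simp add: mult_ac)
        then have bound: "exp (W / (8 * L) * t) * (L2_norm_on L (U t))\<^sup>2 \<le> 2 * (L2_norm_on L U0)\<^sup>2"
          using L(1) by simp
        define s where "s = exp (- (W / (16 * L)) * t)"
        have "s\<^sup>2 * exp (W / (8 * L) * t) = 1"
          unfolding s_def exp_double[symmetric] exp_add[symmetric] by simp
        then have "(L2_norm_on L (U t))\<^sup>2 = s\<^sup>2 * (exp (W / (8 * L) * t) * (L2_norm_on L (U t))\<^sup>2)"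
          by (simp only: mult.assoc[symmetric])
        also have "\<dots> \<le> s\<^sup>2 * (2 * (L2_norm_on L U0)\<^sup>2)"
          by (rule mult_left_mono[OF bound]) simp
        also have "\<dots> = (sqrt 2 * s * L2_norm_on L U0)\<^sup>2"
          by (simp add: power_mult_distrib)
        finally have "(L2_norm_on L (U t))\<^sup>2 \<le> (sqrt 2 * exp (- (W / (16 * L)) * t) * L2_norm_on L U0)\<^sup>2"
          unfolding s_def .
        then show ?thesis
          by (rule power2_le_imp_le) (simp add: pos)
      qed
    qed
    show "\<exists>\<kappa>>0. \<forall>k4 :: real. \<bar>k4\<bar> \<le> \<kappa> \<longrightarrow>
       (\<forall>U0 U. in_Lp 2 (Omega L) (\<lambda>(x, y). U0 x y) \<longrightarrow>
          ibvp_solution g k l H W L k1 k2 k3 k4 U0 U \<longrightarrow>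
          (AE t in lborel. 0 < t \<longrightarrow> BC g H W L U t \<ge> 0)) \<and>
       (\<exists>\<nu>>0. \<exists>C>0. \<forall>U0 U. in_Lp 2 (Omega L) (\<lambda>(x, y). U0 x y) \<longrightarrow>
          ibvp_solution g k l H W L k1 k2 k3 k4 U0 U \<longrightarrow>
          (\<forall>t\<ge>0. L2_norm_on L (U t) \<le> C * exp (- \<nu> * t) * L2_norm_on L U0))"
    proof (rule exI[of _ \<kappa>], intro conjI allI impI)
      fix k4 :: real
      assume k4: "\<bar>k4\<bar> \<le> \<kappa>"
      show "\<exists>\<nu>>0. \<exists>C>0. \<forall>U0 U. in_Lp 2 (Omega L) (\<lambda>(x, y). U0 x y) \<longrightarrow>
          ibvp_solution g k l H W L k1 k2 k3 k4 U0 U \<longrightarrow>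
          (\<forall>t\<ge>0. L2_norm_on L (U t) \<le> C * exp (- \<nu> * t) * L2_norm_on L U0)"
      proof (rule exI[of _ "W / (16 * L)"], rule conjI)
        show "0 < W / (16 * L)" using L(1) \<open>0 < W\<close> by simp
        show "\<exists>C>0. \<forall>U0 U. in_Lp 2 (Omega L) (\<lambda>(x, y). U0 x y) \<longrightarrow>
            ibvp_solution g k l H W L k1 k2 k3 k4 U0 U \<longrightarrow>
            (\<forall>t\<ge>0. L2_norm_on L (U t) \<le> C * exp (- (W / (16 * L)) * t) * L2_norm_on L U0)"
        proof (rule exI[of _ "sqrt 2"], intro conjI allI impI)
          show "0 < sqrt 2" by simp
        qed (rule decay[OF _ k4])
      qed
    qed (use \<kappa> nonneg in auto)
  qed fact
qed

end
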